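(* Let $\alpha=\{\alpha_k\}_{k\in\mathbb{Z}}\subset\mathbb{D}$ with associated CMV operator $U$ on $\ell^2(\mathbb{Z})$, and let $k\in\mathbb{Z}$. Then $$L_j(U,k)=2i\oint_{\partial\mathbb{D}}d\mu_0(\zeta)\,\Xi_{1,1}(\zeta,k)\,\overline{\zeta}^{\,j},\quad j\in\mathbb{N}.$$ In particular, $$L_1(U,k)=-2\alpha_k\overline{\alpha_{k+1}}=2i\oint_{\partial\mathbb{D}}d\mu_0(\zeta)\,\Xi_{1,1}(\zeta,k)\,\overline{\zeta}.$$
   Context: Notation. $\mathbb{D}=\{z\in\mathbb{C}: |z|<1\}$, $\partial\mathbb{D}$ is the unit circle, $\mu_0$ is normalized Lebesgue measure on $\partial\mathbb{D}$ ($d\mu_0=d\theta/(2\pi)$), $\mathbb{N}=\{1,2,\dots\}$. The scalar product on $\ell^2(\mathbb{Z})$ is linear in the second argument and $\{\delta_k\}_{k\in\mathbb{Z}}$ is the standard basis. CMV operator. For $\alpha=\{\alpha_k\}_{k\in\mathbb{Z}}\subset\mathbb{D}$ put $\rho_k=\sqrt{1-|\alpha_k|^2}$ and $$\theta_k=\begin{pmatrix}-\alpha_k&\rho_k\\ \rho_k&\overline{\alpha_k}\end{pmatrix},\quad k\in\mathbb{Z}.$$ Let $V$ be the block-diagonal unitary operator on $\ell^2(\mathbb{Z})$ whose block on the indices $\{2k-1,2k\}$ is $\theta_{2k}$, and $W$ the block-diagonal unitary operator whose block on the indices $\{2k,2k+1\}$ is $\theta_{2k+1}$, $k\in\mathbb{Z}$.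 The CMV operator is the unitary operator $U=VW$ on $\ell^2(\mathbb{Z})$. The function $M_{1,1}$. For $z\in\mathbb{D}$, $k\in\mathbb{Z}$, let $$M_{1,1}(z,k)=\big(\delta_k,(U+zI)(U-zI)^{-1}\delta_k\big)_{\ell^2(\mathbb{Z})}.$$ It is analytic on $\mathbb{D}$ with positive real part and $M_{1,1}(0,k)=1$; $\ln(M_{1,1})$ is taken with the principal branch. Define $$\Xi_{1,1}(\zeta,k)=\lim_{r\uparrow1}\operatorname{Im}[\ln(M_{1,1}(r\zeta,k))]\in[-\pi/2,\pi/2],$$ which exists for $\mu_0$-a.e. $\zeta\in\partial\mathbb{D}$. The quantities $L_j$. Put $M_j(U,k)=2\big(\delta_k,(U^* )^j\delta_k\big)_{\ell^2(\mathbb{Z})}$ for $j\in\mathbb{N}$, and define recursively $$L_1(U,k)=M_1(U,k),\qquad L_j(U,k)=M_j(U,k)-\sum_{\ell=1}^{j-1}\frac{\ell}{j}\,M_{j-\ell}(U,k)\,L_\ell(U,k),\quad j=2,3,\dots.$$ *)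

theory Defs
  imports "HOL-Probability.Probability" "HOL-Complex_Analysis.Complex_Analysis"
begin

definition ell2 :: "(int \<Rightarrow> complex) set" where
  "ell2 = {f. (\<lambda>n. (cmod (f n))\<^sup>2) summable_on UNIV}"

text \<open>The scalar product is linear in the second argument.\<close>

definition ip :: "(int \<Rightarrow> complex) \<Rightarrow> (int \<Rightarrow> complex) \<Rightarrow> complex" where
  "ip f g = (\<Sum>\<^sub>\<infinity>n. cnj (f n) * g n)"

definition delta :: "int \<Rightarrow> int \<Rightarrow> complex" where
  "delta k n = (if n = k then 1 else 0)"

text \<open>Operators on \<open>ell2\<close> are functions on all of \<open>int \<Rightarrow> complex\<close>, of which only the restriction
  to \<open>ell2\<close> matters. For \<open>A\<close> bounded and linear on \<open>ell2\<close> and \<open>g \<in> ell2\<close>, the \<open>h\<close> below exists and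
  is unique.\<close>

definition hadjoint ::
    "((int \<Rightarrow> complex) \<Rightarrow> (int \<Rightarrow> complex)) \<Rightarrow> (int \<Rightarrow> complex) \<Rightarrow> (int \<Rightarrow> complex)" where
  "hadjoint A g = (THE h. h \<in> ell2 \<and> (\<forall>f\<in>ell2. ip (A f) g = ip f h))"

definition cmv_rho :: "(int \<Rightarrow> complex) \<Rightarrow> int \<Rightarrow> real" where
  "cmv_rho \<alpha> k = sqrt (1 - (cmod (\<alpha> k))\<^sup>2)"

definition cmv_theta :: "(int \<Rightarrow> complex) \<Rightarrow> int \<Rightarrow> complex ^ 2 ^ 2" where
  "cmv_theta \<alpha> k =
     vector [vector [- \<alpha> k, of_real (cmv_rho \<alpha> k)],
             vector [of_real (cmv_rho \<alpha> k), cnj (\<alpha> k)]]"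

text \<open>The block of \<open>V\<close> on the indices \<open>{m - 1, m}\<close>, \<open>m\<close> even, is \<open>cmv_theta \<alpha> m\<close>; likewise for \<open>W\<close>
  with \<open>m\<close> odd. An index \<open>n\<close> is the first index of its block (\<open>m = n + 1\<close>) or the second
  (\<open>m = n\<close>), according to its parity.\<close>

definition cmv_V :: "(int \<Rightarrow> complex) \<Rightarrow> (int \<Rightarrow> complex) \<Rightarrow> (int \<Rightarrow> complex)" where
  "cmv_V \<alpha> f n =
     (if odd n then (cmv_theta \<alpha> (n + 1) *v vector [f n, f (n + 1)]) $ 1
      else (cmv_theta \<alpha> n *v vector [f (n - 1), f n]) $ 2)"

definition cmv_W :: "(int \<Rightarrow> complex) \<Rightarrow> (int \<Rightarrow> complex) \<Rightarrow> (int \<Rightarrow> complex)" where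
  "cmv_W \<alpha> f n =
     (if even n then (cmv_theta \<alpha> (n + 1) *v vector [f n, f (n + 1)]) $ 1
      else (cmv_theta \<alpha> n *v vector [f (n - 1), f n]) $ 2)"

definition cmv_U :: "(int \<Rightarrow> complex) \<Rightarrow> (int \<Rightarrow> complex) \<Rightarrow> (int \<Rightarrow> complex)" where
  "cmv_U \<alpha> = cmv_V \<alpha> \<circ> cmv_W \<alpha>"

text \<open>The inverse is that of \<open>U - z I\<close> as an operator on \<open>ell2\<close>, not on all sequences.\<close>

definition cmv_resolvent :: "(int \<Rightarrow> complex) \<Rightarrow> complex \<Rightarrow> (int \<Rightarrow> complex) \<Rightarrow> (int \<Rightarrow> complex)" where
  "cmv_resolvent \<alpha> z = inv_into ell2 (\<lambda>f n. cmv_U \<alpha> f n - z * f n)"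

definition cmv_M11 :: "(int \<Rightarrow> complex) \<Rightarrow> complex \<Rightarrow> int \<Rightarrow> complex" where
  "cmv_M11 \<alpha> z k =
     ip (delta k) (((\<lambda>f n. cmv_U \<alpha> f n + z * f n) \<circ> cmv_resolvent \<alpha> z) (delta k))"

text \<open>At the exceptional \<open>\<zeta>\<close> for which the radial limit does not exist, \<open>Lim\<close> takes an unspecified
  value.\<close>

definition cmv_Xi11 :: "(int \<Rightarrow> complex) \<Rightarrow> complex \<Rightarrow> int \<Rightarrow> real" where
  "cmv_Xi11 \<alpha> \<zeta> k = Lim (at_left 1) (\<lambda>r. Im (Ln (cmv_M11 \<alpha> (of_real r * \<zeta>) k)))"

text \<open>Normalized Lebesgue measure on the unit circle: the (completed) image of
  \<open>d\<theta> / (2 \<pi>)\<close> on \<open>[0, 2 \<pi>)\<close> under \<open>\<theta> \<mapsto> exp (\<i> \<theta>)\<close>.\<close>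

definition mu0 :: "complex measure" where
  "mu0 = completion
     (distr (uniform_measure lborel {0..<2 * pi}) (restrict_space borel (sphere 0 1)) cis)"

definition cmv_Mj :: "(int \<Rightarrow> complex) \<Rightarrow> int \<Rightarrow> nat \<Rightarrow> complex" where
  "cmv_Mj \<alpha> k j = 2 * ip (delta k) ((hadjoint (cmv_U \<alpha>) ^^ j) (delta k))"

text \<open>Only \<open>j \<ge> 1\<close> is meaningful.\<close>

function cmv_L :: "(int \<Rightarrow> complex) \<Rightarrow> int \<Rightarrow> nat \<Rightarrow> complex" where
  "cmv_L \<alpha> k j =
     (if j = 1 then cmv_Mj \<alpha> k 1
      else cmv_Mj \<alpha> k j
             - (\<Sum>l = 1..j - 1. of_nat l / of_nat j * cmv_Mj \<alpha> k (j - l) * cmv_L \<alpha> k l))"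
  by pat_completeness auto
termination
  by (relation "Wellfounded.measure (\<lambda>(\<alpha>, k, j). j)") auto

declare cmv_L.simps [simp del]

end

theory Submission
  imports Defs
begin

text \<open>Let \<open>F(z) = ln M(z)\<close> with \<open>M(z) = M_{1,1}(z, k)\<close>. The resolvent of the unitary operator \<open>U\<close> has the
  geometric expansion \<open>(U - z)\<inverse> = \<Sum> z^n (U*)^(n+1)\<close> on the disc, so \<open>M(z) = 1 + \<Sum> M_j z^j\<close>, and the
  identity \<open>M' = M F'\<close> turns into the recursion that defines \<open>L_j\<close>: thus \<open>F(z) = \<Sum> L_j z^j\<close>. Since
  \<open>Re M > 0\<close>, the imaginary part of \<open>F\<close> lies between \<open>-\<pi>/2\<close> and \<open>\<pi>/2\<close>. On a circle of radius \<open>r < 1\<close>,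
  \<open>Im F = (F - cnj F) / (2 i)\<close> has the \<open>j\<close>-th Fourier coefficient \<open>L_j r^j / (2 i)\<close> for \<open>j \<ge> 1\<close>. Letting
  \<open>r\<close> tend to 1 under the integral gives the theorem, by dominated convergence, as soon as the
  radial limit \<open>\<Xi>\<close> of \<open>Im F\<close> is known to exist almost everywhere. For \<open>j = 1\<close>, \<open>L\<^sub>1 = M\<^sub>1\<close> is twice the
  conjugate of the diagonal entry \<open>U_{kk} = - cnj \<alpha>_k \<alpha>_{k+1}\<close>, read off from the block matrices.

  The existence of radial limits is Fatou's theorem, and most of the text proves it. Because the
  mean of \<open>F\<^sup>2\<close> over a circle is \<open>F(0)\<^sup>2 = 0\<close>, the mean of \<open>|F|\<^sup>2\<close> is twice that of \<open>(Im F)\<^sup>2\<close>; so the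
  coefficients of \<open>F\<close> are square-summable (\<open>square_summable_of_bounded_Im\<close>), and it suffices to treat
  power series with square-summable coefficients (\<open>radial_limits_square_summable\<close>). Polynomials have
  radial limits everywhere, and the tail of the series is controlled by a weak-type bound on its
  radial maximal function. For this the Poisson integral of \<open>|F|\<close> is dominated by the one-sided
  averages of \<open>|F|\<close> over arcs (\<open>poisson_mean_le\<close>), and the maximal averages obey a Hardy-Littlewood
  inequality (\<open>maximal_inequality\<close>) that follows from Garsia's argument for the maximal ergodic
  theorem, applied to a rotation by a small angle (\<open>discrete_maximal_inequality\<close>).\<close>

section \<open>The CMV operator on square-summable sequences\<close>

lemma ell2_summable: "f \<in> ell2 \<Longrightarrow> (\<lambda>n. (cmod (f n))\<^sup>2) summable_on UNIV"
  by (simp add: ell2_def)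

lemma ell2I_bound:
  assumes g: "g summable_on (UNIV :: int set)" and le: "\<And>n. (cmod (f n))\<^sup>2 \<le> g n"
  shows "f \<in> ell2"
proof -
  have g0: "0 \<le> g n" for n
    using le[of n] zero_le_power2[of "cmod (f n)"] by (rule order_trans[rotated])
  have "(\<lambda>n. norm ((cmod (f n))\<^sup>2)) summable_on UNIV"
  proof (rule Infinite_Sum.abs_summable_on_comparison_test)
    show "(\<lambda>n. norm (g n)) summable_on UNIV" using g by (simp add: g0)
    show "norm ((cmod (f n))\<^sup>2) \<le> norm (g n)" for n using le[of n] g0[of n] by simp
  qed
  then show ?thesis
    by (auto simp: ell2_def intro: abs_summable_summable)
qed

lemma ell2_lincomb:
  assumes "f \<in> ell2" "g \<in> ell2"
  shows "(\<lambda>n. a * f n + b * g n) \<in> ell2"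
proof (rule ell2I_bound)
  show "(\<lambda>n. 2 * (cmod a)\<^sup>2 * (cmod (f n))\<^sup>2 + 2 * (cmod b)\<^sup>2 * (cmod (g n))\<^sup>2) summable_on UNIV"
    by (intro summable_on_add summable_on_cmult_right ell2_summable assms)
  fix n
  have "(cmod (a * f n + b * g n))\<^sup>2 \<le> (cmod (a * f n) + cmod (b * g n))\<^sup>2"
    by (intro power_mono norm_triangle_ineq) auto
  also have "\<dots> \<le> 2 * (cmod (a * f n))\<^sup>2 + 2 * (cmod (b * g n))\<^sup>2"
    using sum_squares_bound[of "cmod (a * f n)" "cmod (b * g n)"] by (simp add: power2_sum)
  finally show "(cmod (a * f n + b * g n))\<^sup>2
      \<le> 2 * (cmod a)\<^sup>2 * (cmod (f n))\<^sup>2 + 2 * (cmod b)\<^sup>2 * (cmod (g n))\<^sup>2"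
    by (simp add: norm_mult power_mult_distrib)
qed

lemma ell2_shift:
  assumes "f \<in> ell2"
  shows "(\<lambda>n. f (n + d)) \<in> ell2"
proof -
  have "bij_betw (\<lambda>n::int. n + d) UNIV UNIV"
    by (rule bij_betw_byWitness[where f' = "\<lambda>n. n - d"]) auto
  from summable_on_reindex_bij_betw[OF this, of "\<lambda>n. (cmod (f n))\<^sup>2"] show ?thesis
    using assms by (simp add: ell2_def)
qed

lemma delta_in_ell2: "delta k \<in> ell2"
proof -
  have "(\<lambda>n. (cmod (delta k n))\<^sup>2) summable_on {k}" by simp
  then have "(\<lambda>n. (cmod (delta k n))\<^sup>2) summable_on UNIV"
    by (rule summable_on_cong_neutral[THEN iffD1, rotated -1]) (auto simp: delta_def)
  then show ?thesis by (simp add: ell2_def)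
qed

lemma ip_summable:
  assumes "f \<in> ell2" "g \<in> ell2"
  shows "(\<lambda>n. cnj (f n) * g n) summable_on UNIV"
proof -
  have "(\<lambda>n. norm (cnj (f n) * g n)) summable_on UNIV"
  proof (rule Infinite_Sum.abs_summable_on_comparison_test)
    show "(\<lambda>n. norm ((cmod (f n))\<^sup>2 + (cmod (g n))\<^sup>2)) summable_on UNIV"
      using assms by (simp add: ell2_def summable_on_add)
    show "norm (cnj (f n) * g n) \<le> norm ((cmod (f n))\<^sup>2 + (cmod (g n))\<^sup>2)" for n
    proof -
      have "0 \<le> cmod (f n) * cmod (g n)" by simp
      then have "cmod (f n) * cmod (g n) \<le> (cmod (f n))\<^sup>2 + (cmod (g n))\<^sup>2"
        using sum_squares_bound[of "cmod (f n)" "cmod (g n)"] by linarith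
      then show ?thesis by (simp add: norm_mult)
    qed
  qed
  then show ?thesis by (rule abs_summable_summable)
qed

lemma ip_delta: "ip (delta k) g = g k"
proof -
  have "ip (delta k) g = (\<Sum>\<^sub>\<infinity>n\<in>{k}. cnj (delta k n) * g n)"
    unfolding ip_def by (rule infsum_cong_neutral) (auto simp: delta_def)
  then show ?thesis by (simp add: delta_def)
qed

lemma ip_self: "ip f f = of_real (\<Sum>\<^sub>\<infinity>n. (cmod (f n))\<^sup>2)"
proof -
  have "ip f f = (\<Sum>\<^sub>\<infinity>n. of_real ((cmod (f n))\<^sup>2))"
    unfolding ip_def by (intro infsum_cong) (metis complex_norm_square mult.commute)
  also have "\<dots> = of_real (\<Sum>\<^sub>\<infinity>n. (cmod (f n))\<^sup>2)"
  proof (cases "(\<lambda>n. (cmod (f n))\<^sup>2) summable_on UNIV")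
    case True
    then show ?thesis
      by (metis has_sum_infsum has_sum_of_real infsumI)
  next
    case False
    then have "\<not> (\<lambda>n. complex_of_real ((cmod (f n))\<^sup>2)) summable_on UNIV"
      by (metis (mono_tags, lifting) Re_complex_of_real summable_on_Re summable_on_cong)
    with False show ?thesis by (simp add: infsum_not_exists)
  qed
  finally show ?thesis .
qed

lemma entry_le_norm:
  assumes "f \<in> ell2"
  shows "(cmod (f n))\<^sup>2 \<le> Re (ip f f)"
proof -
  have "(\<Sum>n\<in>{n}. (cmod (f n))\<^sup>2) \<le> (\<Sum>\<^sub>\<infinity>n. (cmod (f n))\<^sup>2)"
    by (rule finite_sum_le_infsum) (use assms in \<open>auto simp: ell2_def\<close>)
  then show ?thesis by (simp add: ip_self)
qed

lemma cmv_rho_sq: "cmod (\<alpha> k) < 1 \<Longrightarrow> (cmv_rho \<alpha> k)\<^sup>2 = 1 - (cmod (\<alpha> k))\<^sup>2"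
  by (simp add: cmv_rho_def power_le_one abs_square_le_1)

lemma cmv_rho_bounds: "cmod (\<alpha> k) < 1 \<Longrightarrow> 0 \<le> cmv_rho \<alpha> k \<and> cmv_rho \<alpha> k \<le> 1"
  by (simp add: cmv_rho_def power_le_one abs_square_le_1)

text \<open>Both factors of \<open>U\<close> have the same shape: the block with matrix \<open>\<theta>\<^sub>m\<close> sits on the indices
  \<open>{m - 1, m}\<close> for those \<open>m\<close> with \<open>m + s\<close> even, where \<open>s = 0\<close> gives \<open>V\<close> and \<open>s = 1\<close> gives \<open>W\<close>.\<close>

definition block_op :: "int \<Rightarrow> (int \<Rightarrow> complex) \<Rightarrow> (int \<Rightarrow> complex) \<Rightarrow> (int \<Rightarrow> complex)" where
  "block_op s \<alpha> f n =
     (if odd (n + s) then - \<alpha> (n + 1) * f n + of_real (cmv_rho \<alpha> (n + 1)) * f (n + 1)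
      else of_real (cmv_rho \<alpha> n) * f (n - 1) + cnj (\<alpha> n) * f n)"

lemma cmv_U_blocks: "cmv_U \<alpha> f = block_op 0 \<alpha> (block_op 1 \<alpha> f)"
proof -
  have "cmv_V \<alpha> f = block_op 0 \<alpha> f" "cmv_W \<alpha> f = block_op 1 \<alpha> f" for f
    by (auto simp: fun_eq_iff cmv_V_def cmv_W_def block_op_def cmv_theta_def
        matrix_vector_mult_def sum_2)
  then show ?thesis by (simp add: cmv_U_def)
qed

lemma block_op_ell2:
  assumes \<alpha>: "\<And>n. cmod (\<alpha> n) < 1" and f: "f \<in> ell2"
  shows "block_op s \<alpha> f \<in> ell2"
proof (rule ell2I_bound)
  show "(\<lambda>n. 2 * ((cmod (f n))\<^sup>2 + (cmod (f (n + 1)))\<^sup>2 + (cmod (f (n + - 1)))\<^sup>2)) summable_on UNIV"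
    by (intro summable_on_cmult_right summable_on_add ell2_summable f ell2_shift)
  fix n
  have *: "(cmod (a * x + b * y))\<^sup>2 \<le> 2 * ((cmod x)\<^sup>2 + (cmod y)\<^sup>2)"
    if "cmod a \<le> 1" "cmod b \<le> 1" for a b x y :: complex
  proof -
    have "cmod (a * x + b * y) \<le> cmod (a * x) + cmod (b * y)" by (rule norm_triangle_ineq)
    also have "\<dots> \<le> cmod x + cmod y"
      using that by (auto simp: norm_mult intro!: add_mono mult_left_le_one_le)
    finally have "(cmod (a * x + b * y))\<^sup>2 \<le> (cmod x + cmod y)\<^sup>2"
      by (rule power_mono) simp
    also have "\<dots> \<le> 2 * ((cmod x)\<^sup>2 + (cmod y)\<^sup>2)"
      using sum_squares_bound[of "cmod x" "cmod y"] by (simp add: power2_sum)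
    finally show ?thesis .
  qed
  show "(cmod (block_op s \<alpha> f n))\<^sup>2
      \<le> 2 * ((cmod (f n))\<^sup>2 + (cmod (f (n + 1)))\<^sup>2 + (cmod (f (n + - 1)))\<^sup>2)"
    using *[of "- \<alpha> (n+1)" "of_real (cmv_rho \<alpha> (n+1))" "f n" "f (n+1)"]
      *[of "of_real (cmv_rho \<alpha> n)" "cnj (\<alpha> n)" "f (n-1)" "f n"]
      less_imp_le[OF \<alpha>[of n]] less_imp_le[OF \<alpha>[of "n+1"]]
      cmv_rho_bounds[of \<alpha> n, OF \<alpha>] cmv_rho_bounds[of \<alpha> "n + 1", OF \<alpha>]
    by (auto simp: block_op_def intro: order_trans)
qed

text \<open>Regrouping along the blocks reduces identities between scalar products to identities for
  a single two by two block.\<close>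

lemma infsum_consecutive_pairs:
  fixes f :: "int \<Rightarrow> complex"
  assumes "f summable_on UNIV"
  shows "infsum f UNIV = (\<Sum>\<^sub>\<infinity>m. f (2 * m - 1 - s) + f (2 * m - s))"
proof -
  let ?a = "\<lambda>m::int. 2 * m - 1 - s" and ?b = "\<lambda>m::int. 2 * m - s"
  have inj: "inj ?a" "inj ?b" by (auto simp: inj_def)
  have ab: "range ?a \<union> range ?b = UNIV" "range ?a \<inter> range ?b = {}"
  proof -
    have "x \<in> range ?a \<union> range ?b" for x
      by (cases "even (x + s)") (auto elim!: evenE oddE simp: image_iff, presburger+)
    then show "range ?a \<union> range ?b = UNIV" by blast
    show "range ?a \<inter> range ?b = {}" by (auto simp: image_iff) presburger
  qed
  have sub: "f summable_on range ?a" "f summable_on range ?b"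
    using assms summable_on_subset_banach by blast+
  have "infsum f UNIV = infsum f (range ?a) + infsum f (range ?b)"
    using infsum_Un_disjoint[OF sub ab(2)] ab(1) by simp
  also have "\<dots> = infsum (f \<circ> ?a) UNIV + infsum (f \<circ> ?b) UNIV"
    by (simp only: infsum_reindex[OF inj(1)] infsum_reindex[OF inj(2)])
  also have "\<dots> = (\<Sum>\<^sub>\<infinity>m. f (?a m) + f (?b m))"
    using sub by (subst infsum_add) (simp_all add: summable_on_reindex[OF inj(1)]
        summable_on_reindex[OF inj(2)] o_def)
  finally show ?thesis .
qed

abbreviation (input) conj_seq :: "(int \<Rightarrow> complex) \<Rightarrow> int \<Rightarrow> complex" where
  "conj_seq \<alpha> \<equiv> \<lambda>n. cnj (\<alpha> n)"

lemma cmv_rho_cnj [simp]: "cmv_rho (conj_seq \<alpha>) = cmv_rho \<alpha>"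
  by (auto simp: cmv_rho_def)

text \<open>Since \<open>\<rho>\<close> depends only on \<open>|\<alpha>|\<close>, the adjoint of \<open>\<theta>\<^sub>m\<close> is the same matrix for \<open>cnj \<alpha>\<close>.\<close>

lemma block_op_adjoint:
  assumes \<alpha>: "\<And>n. cmod (\<alpha> n) < 1" and f: "f \<in> ell2" and g: "g \<in> ell2"
  shows "ip (block_op s \<alpha> f) g = ip f (block_op s (conj_seq \<alpha>) g)"
proof -
  have B: "block_op s \<alpha> f \<in> ell2" "block_op s (conj_seq \<alpha>) g \<in> ell2"
    by (rule block_op_ell2; simp add: assms)+
  show ?thesis
    unfolding ip_def infsum_consecutive_pairs[OF ip_summable[OF B(1) g], of s]
      infsum_consecutive_pairs[OF ip_summable[OF f B(2)], of s]
    by (rule infsum_cong) (simp add: block_op_def algebra_simps)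
qed

lemma block_op_inverse:
  assumes \<alpha>: "\<And>n. cmod (\<alpha> n) < 1"
  shows "block_op s \<alpha> (block_op s (conj_seq \<alpha>) f) = f"
proof
  fix n
  have e: "\<alpha> m * cnj (\<alpha> m) + of_real (cmv_rho \<alpha> m) * of_real (cmv_rho \<alpha> m) = 1" for m
    using cmv_rho_sq[of \<alpha> m, OF \<alpha>]
    by (simp only: complex_norm_square[symmetric] power2_eq_square[symmetric] of_real_power[symmetric]
        of_real_add[symmetric]) simp
  have "block_op s \<alpha> (block_op s (conj_seq \<alpha>) f) n =
     (if odd (n + s) then (\<alpha> (n+1) * cnj (\<alpha> (n+1)) + of_real (cmv_rho \<alpha> (n+1)) * of_real (cmv_rho \<alpha> (n+1))) * f n
      else (\<alpha> n * cnj (\<alpha> n) + of_real (cmv_rho \<alpha> n) * of_real (cmv_rho \<alpha> n)) * f n)"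
    by (simp add: block_op_def algebra_simps)
  then show "block_op s \<alpha> (block_op s (conj_seq \<alpha>) f) n = f n"
    by (simp add: e)
qed

lemma block_op_sums:
  assumes "\<And>n. (\<lambda>m. x m n) sums f n"
  shows "(\<lambda>m. block_op s \<alpha> (x m) n) sums block_op s \<alpha> f n"
  unfolding block_op_def by (cases "odd (n + s)") (simp only: if_True if_False not_True_eq_False simp_thms; intro sums_add sums_mult assms)+

lemma block_op_scale: "block_op s \<alpha> (\<lambda>n. c * f n) = (\<lambda>n. c * block_op s \<alpha> f n)"
  by (auto simp: block_op_def fun_eq_iff algebra_simps)

lemma block_op_diff: "block_op s \<alpha> (\<lambda>n. f n - g n) = (\<lambda>n. block_op s \<alpha> f n - block_op s \<alpha> g n)"
  by (auto simp: block_op_def fun_eq_iff algebra_simps)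

text \<open>\<open>U* = W* V*\<close>, with the adjoints of the factors obtained by conjugating \<open>\<alpha>\<close>. This explicit formula
  acts on finitely many entries at a time, and hence commutes with entrywise convergent series.\<close>

definition cmv_Ustar :: "(int \<Rightarrow> complex) \<Rightarrow> (int \<Rightarrow> complex) \<Rightarrow> (int \<Rightarrow> complex)" where
  "cmv_Ustar \<alpha> f = block_op 1 (conj_seq \<alpha>) (block_op 0 (conj_seq \<alpha>) f)"

context
  fixes \<alpha> :: "int \<Rightarrow> complex"
  assumes \<alpha>: "\<And>n. cmod (\<alpha> n) < 1"
begin

lemma conj_seq_bound: "cmod (conj_seq \<alpha> n) < 1"
  using \<alpha> by simp

lemma cmv_U_ell2: "f \<in> ell2 \<Longrightarrow> cmv_U \<alpha> f \<in> ell2"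
  by (simp add: cmv_U_blocks block_op_ell2 \<alpha>)

lemma cmv_Ustar_ell2: "f \<in> ell2 \<Longrightarrow> cmv_Ustar \<alpha> f \<in> ell2"
  by (simp add: cmv_Ustar_def block_op_ell2 \<alpha>)

lemma ip_cmv_U: "f \<in> ell2 \<Longrightarrow> g \<in> ell2 \<Longrightarrow> ip (cmv_U \<alpha> f) g = ip f (cmv_Ustar \<alpha> g)"
  by (simp add: cmv_U_blocks cmv_Ustar_def block_op_adjoint \<alpha> block_op_ell2)

lemma cmv_U_Ustar: "cmv_U \<alpha> (cmv_Ustar \<alpha> f) = f"
  by (simp add: cmv_U_blocks cmv_Ustar_def block_op_inverse[OF \<alpha>])

lemma cmv_Ustar_U: "cmv_Ustar \<alpha> (cmv_U \<alpha> f) = f"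
  using block_op_inverse[OF conj_seq_bound] by (simp add: cmv_U_blocks cmv_Ustar_def)

text \<open>Testing against the basis vectors shows that at most one sequence represents the adjoint.\<close>

lemma hadjoint_cmv_U:
  assumes g: "g \<in> ell2"
  shows "hadjoint (cmv_U \<alpha>) g = cmv_Ustar \<alpha> g"
  unfolding hadjoint_def
proof (rule the_equality)
  show "cmv_Ustar \<alpha> g \<in> ell2 \<and> (\<forall>f\<in>ell2. ip (cmv_U \<alpha> f) g = ip f (cmv_Ustar \<alpha> g))"
    using g by (simp add: cmv_Ustar_ell2 ip_cmv_U)
  fix h assume h: "h \<in> ell2 \<and> (\<forall>f\<in>ell2. ip (cmv_U \<alpha> f) g = ip f h)"
  then have "ip (delta n) h = ip (delta n) (cmv_Ustar \<alpha> g)" for n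
    using ip_cmv_U[OF delta_in_ell2 g] delta_in_ell2 by metis
  then show "h = cmv_Ustar \<alpha> g" by (simp add: ip_delta fun_eq_iff)
qed

lemma Ustar_pow_delta_ell2: "(cmv_Ustar \<alpha> ^^ j) (delta k) \<in> ell2"
  by (induction j) (simp_all add: delta_in_ell2 cmv_Ustar_ell2)

lemma cmv_Mj_eq: "cmv_Mj \<alpha> k j = 2 * (cmv_Ustar \<alpha> ^^ j) (delta k) k"
proof -
  have "(hadjoint (cmv_U \<alpha>) ^^ j) (delta k) = (cmv_Ustar \<alpha> ^^ j) (delta k)"
    by (induction j) (simp_all add: hadjoint_cmv_U Ustar_pow_delta_ell2)
  then show ?thesis by (simp add: cmv_Mj_def ip_delta)
qed

lemma norm_Ustar_pow_delta: "(\<Sum>\<^sub>\<infinity>n. (cmod ((cmv_Ustar \<alpha> ^^ j) (delta k) n))\<^sup>2) = 1"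
proof -
  have "ip ((cmv_Ustar \<alpha> ^^ j) (delta k)) ((cmv_Ustar \<alpha> ^^ j) (delta k)) = 1"
  proof (induction j)
    case 0
    show ?case by (simp add: ip_delta) (simp add: delta_def)
  next
    case (Suc j)
    let ?x = "(cmv_Ustar \<alpha> ^^ j) (delta k)"
    have "ip (cmv_Ustar \<alpha> ?x) (cmv_Ustar \<alpha> ?x) = ip (cmv_U \<alpha> (cmv_Ustar \<alpha> ?x)) ?x"
      by (simp add: ip_cmv_U cmv_Ustar_ell2 Ustar_pow_delta_ell2)
    with Suc show ?case by (simp add: cmv_U_Ustar)
  qed
  then show ?thesis by (simp add: ip_self)
qed

text \<open>The adjoint is isometric, so that all iterates of a basis vector are unit vectors. Norms over finite
  index sets are the form in which this is passed to the limit in the resolvent series.\<close>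

lemma finite_norm_Ustar_pow_delta:
  assumes "finite X"
  shows "L2_set ((\<lambda>n. cmod ((cmv_Ustar \<alpha> ^^ j) (delta k) n))) X \<le> 1"
proof -
  have "(\<Sum>n\<in>X. (cmod ((cmv_Ustar \<alpha> ^^ j) (delta k) n))\<^sup>2) \<le> 1"
    unfolding norm_Ustar_pow_delta[of j k, symmetric]
    by (rule finite_sum_le_infsum) (use assms ell2_summable[OF Ustar_pow_delta_ell2] in auto)
  then show ?thesis by (simp add: L2_set_def)
qed

lemma entry_Ustar_pow_delta: "cmod ((cmv_Ustar \<alpha> ^^ j) (delta k) n) \<le> 1"
  using finite_norm_Ustar_pow_delta[of "{n}" j k] by simp

lemma cmv_resolvent_series_sums:
  assumes "cmod z < 1"
  shows "(\<lambda>m. z ^ m * (cmv_Ustar \<alpha> ^^ Suc m) (delta k) n) sums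
           (\<Sum>m. z ^ m * (cmv_Ustar \<alpha> ^^ Suc m) (delta k) n)"
proof (rule summable_sums, rule summable_comparison_test')
  show "summable (\<lambda>m. cmod z ^ m)" using assms by (simp add: summable_geometric)
  show "norm (z ^ m * (cmv_Ustar \<alpha> ^^ Suc m) (delta k) n) \<le> cmod z ^ m" if "0 \<le> m" for m
    using entry_Ustar_pow_delta[of "Suc m" k n]
    by (simp add: norm_mult norm_power mult_left_le del: funpow.simps)
qed

text \<open>The sequence \<open>\<Sum> z^m (U*)^(m+1) \<delta>\<^sub>k\<close>, which is \<open>(U - z)\<inverse> \<delta>\<^sub>k\<close> by \<open>U U* = 1\<close>. The series is taken entry
  by entry, so that its membership in the Hilbert space is a separate matter.\<close>

definition resolvent_series :: "complex \<Rightarrow> int \<Rightarrow> int \<Rightarrow> complex" where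
  "resolvent_series z k n = (\<Sum>m. z ^ m * (cmv_Ustar \<alpha> ^^ Suc m) (delta k) n)"

text \<open>By the triangle inequality for finite index sets, all partial sums have norm at most
  \<open>1 / (1 - |z|)\<close>, and this bound survives entrywise convergence.\<close>

lemma resolvent_series_ell2:
  assumes z: "cmod z < 1"
  shows "resolvent_series z k \<in> ell2"
proof -
  let ?s = "\<lambda>N n. \<Sum>m<N. z ^ m * (cmv_Ustar \<alpha> ^^ Suc m) (delta k) n"
  let ?C = "1 / (1 - cmod z)"
  have C: "0 \<le> ?C" using z by simp
  have geo: "(\<Sum>m<N. cmod z ^ m) \<le> ?C" for N
    using sum_le_suminf[of "\<lambda>m. cmod z ^ m" "{..<N}"] z
    by (simp add: summable_geometric suminf_geometric)
  have part: "L2_set (\<lambda>n. cmod (?s N n)) X \<le> (\<Sum>m<N. cmod z ^ m)" if X: "finite X" for N X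
  proof (induction N)
    case 0
    show ?case by (simp add: L2_set_def)
  next
    case (Suc N)
    let ?t = "\<lambda>n. z ^ N * (cmv_Ustar \<alpha> ^^ Suc N) (delta k) n"
    have "L2_set (\<lambda>n. cmod (?s (Suc N) n)) X \<le> L2_set (\<lambda>n. cmod (?s N n) + cmod (?t n)) X"
      by (rule L2_set_mono) (simp_all add: norm_triangle_ineq del: funpow.simps)
    also have "\<dots> \<le> L2_set (\<lambda>n. cmod (?s N n)) X + L2_set (\<lambda>n. cmod (?t n)) X"
      by (rule L2_set_triangle_ineq)
    also have "L2_set (\<lambda>n. cmod (?t n)) X =
        cmod z ^ N * L2_set (\<lambda>n. cmod ((cmv_Ustar \<alpha> ^^ Suc N) (delta k) n)) X"
      by (simp only: norm_mult norm_power L2_set_right_distrib zero_le_power norm_ge_zero)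
    also have "\<dots> \<le> cmod z ^ N"
      using finite_norm_Ustar_pow_delta[OF X, of "Suc N" k] by (simp add: mult_left_le del: funpow.simps)
    finally show ?case using Suc by (simp del: funpow.simps)
  qed
  have "(\<Sum>n\<in>X. (cmod (resolvent_series z k n))\<^sup>2) \<le> ?C\<^sup>2" if X: "finite X" for X
  proof (rule LIMSEQ_le_const2)
    show "(\<lambda>N. \<Sum>n\<in>X. (cmod (?s N n))\<^sup>2) \<longlonglongrightarrow> (\<Sum>n\<in>X. (cmod (resolvent_series z k n))\<^sup>2)"
      using cmv_resolvent_series_sums[OF z, of k]
      by (intro tendsto_intros) (auto simp: resolvent_series_def sums_def)
    have "(\<Sum>n\<in>X. (cmod (?s N n))\<^sup>2) \<le> ?C\<^sup>2" for N
    proof -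
      have "L2_set (\<lambda>n. cmod (?s N n)) X \<le> ?C" using part[OF X] geo order_trans by blast
      then have "(L2_set (\<lambda>n. cmod (?s N n)) X)\<^sup>2 \<le> ?C\<^sup>2" by (intro power_mono) auto
      then show ?thesis by (simp add: L2_set_def sum_nonneg del: funpow.simps)
    qed
    then show "\<exists>N0. \<forall>N\<ge>N0. (\<Sum>n\<in>X. (cmod (?s N n))\<^sup>2) \<le> ?C\<^sup>2" by blast
  qed
  then have "(\<lambda>n. (cmod (resolvent_series z k n))\<^sup>2) summable_on UNIV"
    by (intro nonneg_bdd_above_summable_on) (auto intro!: bdd_aboveI[of _ "?C\<^sup>2"])
  then show ?thesis by (simp add: ell2_def)
qed

lemma resolvent_series_eq:
  assumes z: "cmod z < 1"
  shows "cmv_U \<alpha> (resolvent_series z k) n = z * resolvent_series z k n + delta k n"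
proof -
  let ?u = "\<lambda>m. (cmv_Ustar \<alpha> ^^ m) (delta k)"
  have s: "(\<lambda>m. z ^ m * ?u (Suc m) n) sums resolvent_series z k n" for n
    unfolding resolvent_series_def by (rule cmv_resolvent_series_sums[OF z])
  have "(\<lambda>m. cmv_U \<alpha> (\<lambda>n. z ^ m * ?u (Suc m) n) n) sums cmv_U \<alpha> (resolvent_series z k) n"
    unfolding cmv_U_blocks by (intro block_op_sums s)
  also have "(\<lambda>m. cmv_U \<alpha> (\<lambda>n. z ^ m * ?u (Suc m) n) n) = (\<lambda>m. z ^ m * ?u m n)"
    by (simp add: cmv_U_blocks block_op_scale)
      (simp add: cmv_U_blocks[symmetric] cmv_U_Ustar)
  finally have 1: "(\<lambda>m. z ^ m * ?u m n) sums cmv_U \<alpha> (resolvent_series z k) n" .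
  have "(\<lambda>m. z ^ Suc m * ?u (Suc m) n) sums (z * resolvent_series z k n)"
    using sums_mult[OF s[of n], of z] by (simp add: mult.assoc del: funpow.simps)
  then have "(\<lambda>m. z ^ m * ?u m n) sums (z * resolvent_series z k n + z ^ 0 * ?u 0 n)"
    by (subst (asm) sums_Suc_iff) simp
  with 1 show ?thesis by (simp add: sums_unique2)
qed

lemma norm_cmv_U: "f \<in> ell2 \<Longrightarrow> (\<Sum>\<^sub>\<infinity>n. (cmod (cmv_U \<alpha> f n))\<^sup>2) = (\<Sum>\<^sub>\<infinity>n. (cmod (f n))\<^sup>2)"
  using ip_cmv_U[of f "cmv_U \<alpha> f"] by (simp add: cmv_U_ell2 cmv_Ustar_U ip_self)

lemma sq_norm_pos:
  assumes "f \<in> ell2" "f n \<noteq> 0"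
  shows "0 < (\<Sum>\<^sub>\<infinity>n. (cmod (f n))\<^sup>2)"
  using entry_le_norm[OF assms(1), of n] assms(2) by (simp add: ip_self)
    (meson less_le_trans norm_eq_zero zero_less_power2)

text \<open>A difference \<open>d\<close> of two preimages satisfies \<open>U d = z d\<close>, and as \<open>U\<close> preserves norms while \<open>|z| < 1\<close>,
  it vanishes.\<close>

lemma cmv_U_minus_inj:
  assumes z: "cmod z < 1"
  shows "inj_on (\<lambda>f n. cmv_U \<alpha> f n - z * f n) ell2"
proof (rule inj_onI)
  fix f g assume f: "f \<in> ell2" and g: "g \<in> ell2"
    and e: "(\<lambda>n. cmv_U \<alpha> f n - z * f n) = (\<lambda>n. cmv_U \<alpha> g n - z * g n)"
  define d where "d = (\<lambda>n. f n - g n)"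
  have d: "d \<in> ell2" using ell2_lincomb[OF f g, of 1 "-1"] by (simp add: d_def)
  have "cmv_U \<alpha> d n = z * d n" for n
    using fun_cong[OF e, of n]
    by (simp add: d_def cmv_U_blocks block_op_diff) (simp add: algebra_simps)
  then have "(\<Sum>\<^sub>\<infinity>n. (cmod (d n))\<^sup>2) = (\<Sum>\<^sub>\<infinity>n. (cmod z)\<^sup>2 * (cmod (d n))\<^sup>2)"
    using norm_cmv_U[OF d] by (simp add: norm_mult power_mult_distrib)
  also have "\<dots> = (cmod z)\<^sup>2 * (\<Sum>\<^sub>\<infinity>n. (cmod (d n))\<^sup>2)"
    by (rule infsum_cmult_right) (use ell2_summable[OF d] in auto)
  finally have "(1 - (cmod z)\<^sup>2) * (\<Sum>\<^sub>\<infinity>n. (cmod (d n))\<^sup>2) = 0" by (simp add: algebra_simps)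
  moreover have "(cmod z)\<^sup>2 < 1" using z by (simp add: power_less_one_iff abs_square_less_1)
  ultimately have "(\<Sum>\<^sub>\<infinity>n. (cmod (d n))\<^sup>2) = 0" by simp
  then have "d n = 0" for n using sq_norm_pos[OF d, of n] by auto
  then show "f = g" by (auto simp: d_def fun_eq_iff)
qed

lemma cmv_resolvent_delta:
  assumes z: "cmod z < 1"
  shows "cmv_resolvent \<alpha> z (delta k) = resolvent_series z k"
  unfolding cmv_resolvent_def
  by (rule inv_into_f_eq[OF cmv_U_minus_inj[OF z] resolvent_series_ell2[OF z]])
    (simp add: resolvent_series_eq[OF z])

lemma cmv_M11_eq:
  assumes z: "cmod z < 1"
  shows "cmv_M11 \<alpha> z k = 1 + 2 * z * resolvent_series z k k"
  by (simp add: cmv_M11_def cmv_resolvent_delta[OF z] ip_delta resolvent_series_eq[OF z])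
    (simp add: delta_def)

lemma cmv_M11_sums:
  assumes z: "cmod z < 1"
  shows "(\<lambda>j. (if j = 0 then 1 else cmv_Mj \<alpha> k j) * z ^ j) sums cmv_M11 \<alpha> z k"
proof -
  have "(\<lambda>m. 2 * z * (z ^ m * (cmv_Ustar \<alpha> ^^ Suc m) (delta k) k)) sums (2 * z * resolvent_series z k k)"
    unfolding resolvent_series_def by (intro sums_mult cmv_resolvent_series_sums[OF z])
  then have "(\<lambda>m. (if Suc m = 0 then 1 else cmv_Mj \<alpha> k (Suc m)) * z ^ Suc m)
      sums (2 * z * resolvent_series z k k)"
    by (simp add: cmv_Mj_eq mult_ac del: funpow.simps)
  then show ?thesis
    by (subst (asm) sums_Suc_iff) (simp add: cmv_M11_eq[OF z] add.commute)
qed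

text \<open>With \<open>h = (U - z)\<inverse> \<delta>\<^sub>k\<close> the function is \<open>((U - z) h, (U + z) h)\<close>, whose real part is
  \<open>\<parallel>U h\<parallel>\<^sup>2 - |z|\<^sup>2 \<parallel>h\<parallel>\<^sup>2 = (1 - |z|\<^sup>2) \<parallel>h\<parallel>\<^sup>2\<close>; this is positive because \<open>h \<noteq> 0\<close>.\<close>

lemma Re_cmv_M11_pos:
  assumes z: "cmod z < 1"
  shows "0 < Re (cmv_M11 \<alpha> z k)"
proof -
  let ?h = "resolvent_series z k"
  let ?g = "cmv_U \<alpha> ?h"
  have h: "?h \<in> ell2" by (rule resolvent_series_ell2[OF z])
  have g: "?g \<in> ell2" by (rule cmv_U_ell2[OF h])
  have d: "delta k n = ?g n - z * ?h n" for n by (simp add: resolvent_series_eq[OF z])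
  have p: "(\<lambda>n. ?g n + z * ?h n) \<in> ell2" using ell2_lincomb[OF g h, of 1 z] by simp
  have "Re (cmv_M11 \<alpha> z k) = Re (ip (delta k) (\<lambda>n. ?g n + z * ?h n))"
    by (simp add: cmv_M11_def cmv_resolvent_delta[OF z])
  also have "\<dots> = (\<Sum>\<^sub>\<infinity>n. Re (cnj (delta k n) * (?g n + z * ?h n)))"
    unfolding ip_def by (rule infsum_Re[symmetric]) (rule ip_summable[OF delta_in_ell2 p])
  also have "\<dots> = (\<Sum>\<^sub>\<infinity>n. (cmod (?g n))\<^sup>2 + - (cmod z)\<^sup>2 * (cmod (?h n))\<^sup>2)"
  proof (rule infsum_cong)
    fix n
    have "Re (cnj (a - w) * (a + w)) = (cmod a)\<^sup>2 - (cmod w)\<^sup>2" for a w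
      unfolding cmod_power2 by (simp add: algebra_simps power2_eq_square)
    from this[of "?g n" "z * ?h n"] show "Re (cnj (delta k n) * (?g n + z * ?h n))
        = (cmod (?g n))\<^sup>2 + - (cmod z)\<^sup>2 * (cmod (?h n))\<^sup>2"
      unfolding d norm_mult power_mult_distrib by (simp only: mult_minus_left diff_conv_add_uminus)
  qed
  also have "\<dots> = (\<Sum>\<^sub>\<infinity>n. (cmod (?g n))\<^sup>2) + - (cmod z)\<^sup>2 * (\<Sum>\<^sub>\<infinity>n. (cmod (?h n))\<^sup>2)"
    unfolding infsum_add[OF ell2_summable[OF g] summable_on_cmult_right[OF ell2_summable[OF h]]]
    by (simp only: infsum_cmult_right[OF ell2_summable[OF h]])
  also have "\<dots> = (1 - (cmod z)\<^sup>2) * (\<Sum>\<^sub>\<infinity>n. (cmod (?h n))\<^sup>2)"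
    by (simp add: norm_cmv_U[OF h] algebra_simps)
  finally have eq: "Re (cmv_M11 \<alpha> z k) = (1 - (cmod z)\<^sup>2) * (\<Sum>\<^sub>\<infinity>n. (cmod (?h n))\<^sup>2)" .
  have "(cmod z)\<^sup>2 < 1" using z by (simp add: power_less_one_iff abs_square_less_1)
  moreover have "\<exists>n. ?h n \<noteq> 0"
  proof (rule ccontr)
    assume "\<not> (\<exists>n. ?h n \<noteq> 0)"
    then have "?h = (\<lambda>n. 0)" by auto
    then have "delta k k = 0" using d[of k] by (simp add: cmv_U_blocks block_op_def)
    then show False by (simp add: delta_def)
  qed
  ultimately show ?thesis using sq_norm_pos[OF h] eq by auto
qed

lemma cmv_Mj_1: "cmv_Mj \<alpha> k 1 = - 2 * \<alpha> k * cnj (\<alpha> (k + 1))"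
  by (auto simp: cmv_Mj_eq cmv_Ustar_def block_op_def delta_def)

end

section \<open>Means over the circle\<close>

text \<open>The normalized Lebesgue measure of the circle in the angle variable. Functions on the circle
  are treated as \<open>2\<pi>\<close>-periodic functions on the line, on which rotations are translations.\<close>

definition angle_measure :: "real measure" where
  "angle_measure = uniform_measure lborel {0..<2 * pi}"

lemma sets_angle [measurable_cong, simp]: "sets angle_measure = sets borel"
  and space_angle [simp]: "space angle_measure = UNIV"
  by (simp_all add: angle_measure_def)

lemma prob_space_angle: "prob_space angle_measure"
proof -
  have e: "emeasure lborel {0..<2 * pi} = ennreal (2 * pi)"
    using emeasure_lborel_Ico[of 0 "2 * pi"] by simp
  show ?thesis
    unfolding angle_measure_def
  proof (rule prob_space_uniform_measure, unfold e)
    show "ennreal (2 * pi) \<noteq> 0" "ennreal (2 * pi) \<noteq> \<infinity>" by simp_all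
  qed
qed

interpretation angle: prob_space angle_measure
  by (rule prob_space_angle)

lemma measurable_angle: "continuous_on UNIV h \<Longrightarrow> h \<in> borel_measurable angle_measure"
  using measurable_cong_sets[OF sets_angle refl] borel_measurable_continuous_onI by blast

lemma integrable_angle:
  fixes h :: "real \<Rightarrow> 'a :: {banach, second_countable_topology}"
  assumes h: "continuous_on UNIV h"
  shows "integrable angle_measure h"
proof -
  have "compact (h ` {0..2 * pi})"
    by (intro compact_continuous_image continuous_on_subset[OF h]) auto
  then obtain B where B: "\<And>\<theta>. \<theta> \<in> {0..2 * pi} \<Longrightarrow> norm (h \<theta>) \<le> B"
    using compact_imp_bounded by (fastforce simp: bounded_iff)
  show ?thesis
  proof (rule angle.integrable_const_bound[OF _ measurable_angle[OF h]])
    show "AE \<theta> in angle_measure. norm (h \<theta>) \<le> B"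
      unfolding angle_measure_def
      by (rule AE_uniform_measureI) (use B in \<open>auto intro!: always_eventually\<close>)
  qed
qed

lemma integral_angle:
  fixes h :: "real \<Rightarrow> 'a :: euclidean_space"
  assumes h: "continuous_on UNIV h"
  shows "integral\<^sup>L angle_measure h = (1 / (2 * pi)) *\<^sub>R integral {0..2 * pi} h"
proof -
  have [measurable]: "h \<in> borel_measurable borel"
    using h by (rule borel_measurable_continuous_onI)
  have "angle_measure = density lborel (\<lambda>x. ennreal (indicator {0..<2 * pi} x / (2 * pi)))"
    unfolding angle_measure_def uniform_measure_def
    by (intro arg_cong2[where f = density] refl ext)
       (auto simp: indicator_def divide_ennreal ennreal_1[symmetric] simp del: ennreal_1)
  then have "integral\<^sup>L angle_measure h = (\<integral>x. (indicator {0..<2 * pi} x / (2 * pi)) *\<^sub>R h x \<partial>lborel)"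
    using integral_density[of h lborel "\<lambda>x. indicator {0..<2 * pi} x / (2 * pi)"] by simp
  also have "\<dots> = (\<integral>x. (1 / (2 * pi)) *\<^sub>R (indicator {0..2 * pi} x *\<^sub>R h x) \<partial>lborel)"
  proof (rule integral_cong_AE)
    have "(indicator {0..<2 * pi} x / (2 * pi)) *\<^sub>R h x
        = (1 / (2 * pi)) *\<^sub>R (indicator {0..2 * pi} x *\<^sub>R h x)" if "x \<noteq> 2 * pi" for x
      using that by (auto simp: indicator_def)
    then show "AE x in lborel. (indicator {0..<2 * pi} x / (2 * pi)) *\<^sub>R h x
        = (1 / (2 * pi)) *\<^sub>R (indicator {0..2 * pi} x *\<^sub>R h x)"
      using AE_lborel_singleton[of "2 * pi"] by (auto elim!: eventually_mono)
  qed measurable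
  also have "\<dots> = (1 / (2 * pi)) *\<^sub>R (LINT x:{0..2 * pi}|lborel. h x)"
    unfolding set_lebesgue_integral_def by (rule integral_scaleR_right)
  also have "(LINT x:{0..2 * pi}|lborel. h x) = integral {0..2 * pi} h"
    by (rule set_borel_integral_eq_integral(2))
      (use h in \<open>auto intro!: borel_integrable_atLeastAtMost' continuous_on_subset[OF h]\<close>)
  finally show ?thesis .
qed

lemma mean_cis_int: "integral\<^sup>L angle_measure (\<lambda>\<theta>. cis (of_int n * \<theta>)) = of_bool (n = 0)"
proof (cases "n = 0")
  case True
  then show ?thesis using angle.prob_space by simp
next
  case False
  have "((\<lambda>\<theta>. cis (of_int n * \<theta>)) has_integral
      (cis (of_int n * (2 * pi)) / (\<i> * of_int n) - cis (of_int n * 0) / (\<i> * of_int n))) {0..2 * pi}"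
  proof (rule fundamental_theorem_of_calculus)
    fix x :: real
    have "((\<lambda>w. exp (\<i> * of_int n * w) / (\<i> * of_int n)) has_field_derivative
        exp (\<i> * of_int n * of_real x)) (at (of_real x))"
      by (rule derivative_eq_intros refl | use False in simp)+
    from has_vector_derivative_real_field[OF this]
    show "((\<lambda>\<theta>. cis (of_int n * \<theta>) / (\<i> * of_int n)) has_vector_derivative cis (of_int n * x))
        (at x within {0..2 * pi})"
      by (simp add: cis_conv_exp mult_ac)
  qed simp
  moreover have "cis (of_int n * (2 * pi)) = 1"
    using cis_multiple_2pi[of "of_int n"] by (simp add: mult_ac)
  ultimately have "integral {0..2 * pi} (\<lambda>\<theta>. cis (of_int n * \<theta>)) = 0"
    by (simp add: integral_unique)
  then show ?thesis using False
    by (subst integral_angle) (auto intro!: continuous_intros)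
qed

lemma mean_cis_mult_cnj: "integral\<^sup>L angle_measure (\<lambda>\<theta>. cis \<theta> ^ n * cnj (cis \<theta> ^ m)) = of_bool (n = m)"
  using mean_cis_int[of "int n - int m"]
  by (simp add: Complex.DeMoivre cis_cnj cis_mult algebra_simps)

lemma mean_cis_mult: "integral\<^sup>L angle_measure (\<lambda>\<theta>. cis \<theta> ^ n * cis \<theta> ^ m) = of_bool (n = 0 \<and> m = 0)"
  using mean_cis_int[of "int n + int m"]
  by (simp add: Complex.DeMoivre cis_mult algebra_simps)

text \<open>The boundary values of a power series with absolutely summable coefficients. Values inside the disc
  are obtained by damping the coefficients: \<open>circle_series (\<lambda>n. c n * r ^ n)\<close> is the series on the
  circle of radius \<open>r\<close>.\<close>

definition circle_series :: "(nat \<Rightarrow> complex) \<Rightarrow> real \<Rightarrow> complex" where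
  "circle_series c \<theta> = (\<Sum>n. c n * cis \<theta> ^ n)"

lemma circle_series_summable:
  assumes "summable (\<lambda>n. norm (c n))"
  shows "summable (\<lambda>n. norm (c n * cis \<theta> ^ n))"
  using assms by (simp add: norm_mult norm_power)

lemma circle_series_bound:
  assumes c: "summable (\<lambda>n. norm (c n))"
  shows "norm (circle_series c \<theta>) \<le> (\<Sum>n. norm (c n))"
  using summable_norm[OF circle_series_summable[OF c, of \<theta>]]
  by (simp add: circle_series_def norm_mult norm_power)

lemma circle_series_continuous:
  assumes c: "summable (\<lambda>n. norm (c n))"
  shows "continuous_on S (circle_series c)"
proof -
  have "uniform_limit UNIV (\<lambda>N \<theta>. \<Sum>n<N. c n * cis \<theta> ^ n) (\<lambda>\<theta>. \<Sum>n. c n * cis \<theta> ^ n) sequentially"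
    by (rule Weierstrass_m_test[OF _ c]) (simp add: norm_mult norm_power)
  then have "continuous_on UNIV (\<lambda>\<theta>. \<Sum>n. c n * cis \<theta> ^ n)"
    by (rule uniform_limit_theorem[rotated]) (auto intro!: always_eventually continuous_intros)
  then show ?thesis
    unfolding circle_series_def[abs_def] using continuous_on_subset by blast
qed

text \<open>Integration term by term against a bounded function. Fourier coefficients, Parseval's identity and
  the Poisson formula are all instances.\<close>

lemma mean_circle_series_mult:
  assumes c: "summable (\<lambda>n. norm (c n))"
    and g: "continuous_on UNIV g" "\<And>\<theta>. norm (g \<theta>) \<le> B"
  shows "(\<lambda>n. c n * integral\<^sup>L angle_measure (\<lambda>\<theta>. cis \<theta> ^ n * g \<theta>)) sums
           integral\<^sup>L angle_measure (\<lambda>\<theta>. circle_series c \<theta> * g \<theta>)"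
proof -
  let ?f = "\<lambda>n \<theta>. c n * (cis \<theta> ^ n * g \<theta>)"
  have bd: "norm (?f n \<theta>) \<le> norm (c n) * B" for n \<theta>
    by (simp add: norm_mult norm_power mult_left_mono g(2))
  have cont: "continuous_on UNIV (?f n)" for n
    by (intro continuous_intros g(1))
  have int: "integrable angle_measure (?f n)" for n
    by (rule integrable_angle[OF cont])
  have "(\<lambda>n. integral\<^sup>L angle_measure (?f n)) sums integral\<^sup>L angle_measure (\<lambda>\<theta>. \<Sum>n. ?f n \<theta>)"
  proof (rule sums_integral[OF int])
    have sB: "summable (\<lambda>n. norm (c n) * B)" using c by (rule summable_mult2)
    show "AE \<theta> in angle_measure. summable (\<lambda>n. norm (?f n \<theta>))"
      by (rule always_eventually, rule allI, rule summable_comparison_test'[OF sB]) (use bd in simp)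
    show "summable (\<lambda>n. integral\<^sup>L angle_measure (\<lambda>\<theta>. norm (?f n \<theta>)))"
    proof (rule summable_comparison_test'[OF sB])
      fix n :: nat
      have "integral\<^sup>L angle_measure (\<lambda>\<theta>. norm (?f n \<theta>)) \<le> norm (c n) * B"
        by (rule angle.integral_le_const) (use int bd in auto)
      then show "norm (integral\<^sup>L angle_measure (\<lambda>\<theta>. norm (?f n \<theta>))) \<le> norm (c n) * B"
        by (simp add: integral_nonneg_AE)
    qed
  qed
  moreover have "(\<Sum>n. ?f n \<theta>) = circle_series c \<theta> * g \<theta>" for \<theta>
    using suminf_mult2[OF summable_norm_cancel[OF circle_series_summable[OF c, of \<theta>]], of "g \<theta>"]
    by (simp add: circle_series_def mult.assoc)
  ultimately show ?thesis by simp
qed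

lemma mean_circle_series_cnj_power:
  assumes c: "summable (\<lambda>n. norm (c n))"
  shows "integral\<^sup>L angle_measure (\<lambda>\<theta>. circle_series c \<theta> * cnj (cis \<theta> ^ m)) = c m"
proof -
  have "(\<lambda>n. c n * of_bool (n = m)) sums integral\<^sup>L angle_measure (\<lambda>\<theta>. circle_series c \<theta> * cnj (cis \<theta> ^ m))"
  proof -
    have g: "continuous_on UNIV (\<lambda>\<theta>. cnj (cis \<theta> ^ m))" by (intro continuous_intros)
    have b: "norm (cnj (cis \<theta> ^ m)) \<le> 1" for \<theta> by (simp add: norm_power)
    show ?thesis using mean_circle_series_mult[OF c g b] unfolding mean_cis_mult_cnj .
  qed
  moreover have "(\<lambda>n. c n * of_bool (n = m)) sums c m"
    using sums_single[of m c] by (simp add: of_bool_def if_distrib cong: if_cong)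
  ultimately show ?thesis using sums_unique2 by blast
qed

lemma mean_circle_series_power:
  assumes c: "summable (\<lambda>n. norm (c n))"
  shows "integral\<^sup>L angle_measure (\<lambda>\<theta>. circle_series c \<theta> * cis \<theta> ^ m) = of_bool (m = 0) * c 0"
proof -
  have "(\<lambda>n. c n * of_bool (n = 0 \<and> m = 0)) sums integral\<^sup>L angle_measure (\<lambda>\<theta>. circle_series c \<theta> * cis \<theta> ^ m)"
  proof -
    have g: "continuous_on UNIV (\<lambda>\<theta>. cis \<theta> ^ m)" by (intro continuous_intros)
    have b: "norm (cis \<theta> ^ m) \<le> 1" for \<theta> by (simp add: norm_power)
    show ?thesis using mean_circle_series_mult[OF c g b] unfolding mean_cis_mult .
  qed
  moreover have "(\<lambda>n. c n * of_bool (n = 0 \<and> m = 0)) sums (of_bool (m = 0) * c 0)"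
    using sums_single[of 0 c] by (cases "m = 0") (simp_all add: of_bool_def if_distrib cong: if_cong)
  ultimately show ?thesis using sums_unique2 by blast
qed

text \<open>The mean value property of the square of the series, at the centre of the disc.\<close>

lemma mean_circle_series_square:
  assumes c: "summable (\<lambda>n. norm (c n))"
  shows "integral\<^sup>L angle_measure (\<lambda>\<theta>. circle_series c \<theta> * circle_series c \<theta>) = (c 0)\<^sup>2"
proof -
  have "(\<lambda>n. c n * (of_bool (n = 0) * c 0)) sums
      integral\<^sup>L angle_measure (\<lambda>\<theta>. circle_series c \<theta> * circle_series c \<theta>)"
    using mean_circle_series_mult[OF c circle_series_continuous[OF c] circle_series_bound[OF c]]
      mean_circle_series_power[OF c] by (simp add: mult.commute)
  moreover have "(\<lambda>n. c n * (of_bool (n = 0) * c 0)) sums (c 0)\<^sup>2"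
  proof -
    have "(\<lambda>n. c n * (of_bool (n = 0) * c 0)) = (\<lambda>n. if n = 0 then c n * c 0 else 0)"
      by auto
    then show ?thesis
      using sums_single[of 0 "\<lambda>n. c n * c 0"] by (simp add: power2_eq_square)
  qed
  ultimately show ?thesis using sums_unique2 by blast
qed

lemma parseval_circle_series:
  assumes c: "summable (\<lambda>n. norm (c n))"
  shows "(\<lambda>n. (norm (c n))\<^sup>2) sums integral\<^sup>L angle_measure (\<lambda>\<theta>. (norm (circle_series c \<theta>))\<^sup>2)"
proof -
  have coeff: "integral\<^sup>L angle_measure (\<lambda>\<theta>. cis \<theta> ^ n * cnj (circle_series c \<theta>)) = cnj (c n)" for n
  proof -
    have "(\<lambda>\<theta>. cis \<theta> ^ n * cnj (circle_series c \<theta>))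
        = (\<lambda>\<theta>. cnj (circle_series c \<theta> * cnj (cis \<theta> ^ n)))"
      by (simp add: fun_eq_iff)
    then show ?thesis
      by (simp only: Bochner_Integration.integral_cnj mean_circle_series_cnj_power[OF c])
  qed
  have "(\<lambda>n. c n * cnj (c n)) sums
      integral\<^sup>L angle_measure (\<lambda>\<theta>. circle_series c \<theta> * cnj (circle_series c \<theta>))"
  proof -
    have g: "continuous_on UNIV (\<lambda>\<theta>. cnj (circle_series c \<theta>))"
      by (intro continuous_intros circle_series_continuous[OF c])
    have b: "norm (cnj (circle_series c \<theta>)) \<le> (\<Sum>n. norm (c n))" for \<theta>
      using circle_series_bound[OF c] by simp
    show ?thesis using mean_circle_series_mult[OF c g b] unfolding coeff .
  qed
  then have "(\<lambda>n. complex_of_real ((norm (c n))\<^sup>2)) sums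
      of_real (integral\<^sup>L angle_measure (\<lambda>\<theta>. (norm (circle_series c \<theta>))\<^sup>2))"
    by (simp only: complex_norm_square[symmetric] integral_complex_of_real)
  then show ?thesis by (simp only: sums_of_real_iff)
qed

definition poisson_kernel :: "real \<Rightarrow> real \<Rightarrow> real" where
  "poisson_kernel r t = (1 - r\<^sup>2) / (1 - 2 * r * cos t + r\<^sup>2)"

lemma poisson_denom_pos:
  fixes r :: real
  assumes "0 \<le> r" "r < 1"
  shows "0 < 1 - 2 * r * cos t + r\<^sup>2"
proof -
  have "r * cos t \<le> r * 1" by (rule mult_left_mono) (use assms in auto)
  then have "(1 - r)\<^sup>2 \<le> 1 - 2 * r * cos t + r\<^sup>2" by (simp add: power2_diff)
  moreover have "0 < (1 - r)\<^sup>2" using assms by simp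
  ultimately show ?thesis by linarith
qed

lemma poisson_kernel_nonneg:
  assumes "0 \<le> r" "r < 1"
  shows "0 \<le> poisson_kernel r t"
proof -
  have "r\<^sup>2 \<le> 1" using assms by (simp add: power_le_one)
  then show ?thesis
    using poisson_denom_pos[OF assms, of t] by (simp add: poisson_kernel_def)
qed

lemma poisson_kernel_continuous:
  assumes "0 \<le> r" "r < 1"
  shows "continuous_on S (poisson_kernel r)"
  unfolding poisson_kernel_def
proof (intro continuous_intros ballI)
  show "1 - 2 * r * cos t + r\<^sup>2 \<noteq> 0" for t
    using poisson_denom_pos[OF assms, of t] by simp
qed

text \<open>The Poisson kernel is \<open>\<Sum> r^|n| e^(int)\<close>, summed over all integers \<open>n\<close>: two geometric series
  that share the term for \<open>n = 0\<close>. This determines its Fourier coefficients.\<close>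

lemma poisson_kernel_geometric:
  assumes r: "0 \<le> r" "r < 1"
  defines "G \<equiv> circle_series (\<lambda>n. of_real (r ^ n))"
  shows "of_real (poisson_kernel r t) = G t + cnj (G t) - 1"
proof -
  let ?w = "of_real r * cis t"
  have w: "norm ?w < 1" using r by (simp add: norm_mult)
  then have w1: "1 - ?w \<noteq> 0" by auto
  have G: "G t = 1 / (1 - ?w)"
    using suminf_geometric[OF w] by (simp add: G_def circle_series_def power_mult_distrib)
  have d: "(1 - ?w) * cnj (1 - ?w) = of_real (1 - 2 * r * cos t + r\<^sup>2)"
  proof -
    have "r * (r * (cos t * cos t)) + r * (r * (sin t * sin t)) = r * r"
      unfolding distrib_left[symmetric] by simp
    then show ?thesis
      by (simp add: complex_eq_iff algebra_simps power2_eq_square)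
  qed
  have "G t + cnj (G t) - 1 = (cnj (1 - ?w) + (1 - ?w) - (1 - ?w) * cnj (1 - ?w)) / ((1 - ?w) * cnj (1 - ?w))"
  proof -
    have "1 / u + 1 / v - 1 = (v + u - u * v) / (u * v)" if "u \<noteq> 0" "v \<noteq> 0" for u v :: complex
      using that by (simp add: field_simps)
    from this[of "1 - ?w" "cnj (1 - ?w)"] w1 show ?thesis
      unfolding G by (simp only: complex_cnj_divide complex_cnj_one complex_cnj_zero_iff not_False_eq_True)
  qed
  also have "cnj (1 - ?w) + (1 - ?w) = of_real (2 - 2 * r * cos t)"
    by (simp add: complex_eq_iff)
  finally have "G t + cnj (G t) - 1 = of_real ((2 - 2 * r * cos t - (1 - 2 * r * cos t + r\<^sup>2))
      / (1 - 2 * r * cos t + r\<^sup>2))"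
    unfolding d of_real_diff[symmetric] of_real_divide[symmetric] .
  moreover have "2 - 2 * r * cos t - (1 - 2 * r * cos t + r\<^sup>2) = 1 - r\<^sup>2" by simp
  ultimately show ?thesis by (simp only: poisson_kernel_def)
qed

lemma poisson_kernel_bound:
  assumes r: "0 \<le> r" "r < 1"
  shows "\<exists>B. \<forall>t. norm (poisson_kernel r t) \<le> B"
proof -
  let ?c = "\<lambda>n. complex_of_real (r ^ n)"
  have c: "summable (\<lambda>n. norm (?c n))" using r by (simp add: summable_geometric norm_power)
  have "norm (poisson_kernel r t) \<le> 2 * (\<Sum>n. norm (?c n)) + 1" for t
  proof -
    have "norm (poisson_kernel r t) = norm (complex_of_real (poisson_kernel r t))" by simp
    also have "\<dots> \<le> norm (circle_series ?c t) + norm (cnj (circle_series ?c t)) + norm (1::complex)"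
      unfolding poisson_kernel_geometric[OF r]
      by (rule order_trans[OF norm_triangle_ineq4 add_right_mono[OF norm_triangle_ineq]])
    finally show ?thesis using circle_series_bound[OF c, of t] by simp
  qed
  then show ?thesis by blast
qed

lemma mean_poisson_kernel_power:
  assumes r: "0 \<le> r" "r < 1"
  shows "integral\<^sup>L angle_measure (\<lambda>t. cis t ^ n * of_real (poisson_kernel r t)) = of_real (r ^ n)"
proof -
  let ?c = "\<lambda>n. complex_of_real (r ^ n)"
  have c: "summable (\<lambda>n. norm (?c n))" using r by (simp add: summable_geometric norm_power)
  let ?G = "circle_series ?c"
  note cont = circle_series_continuous[OF c]
  have i: "integrable angle_measure (\<lambda>t. ?G t * cis t ^ n)" "integrable angle_measure (\<lambda>t. ?G t * cnj (cis t ^ n))"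
     "integrable angle_measure (\<lambda>t. cis t ^ n)"
    by (intro integrable_angle continuous_intros cont)+
  have "integral\<^sup>L angle_measure (\<lambda>t. cis t ^ n * of_real (poisson_kernel r t))
      = integral\<^sup>L angle_measure (\<lambda>t. ?G t * cis t ^ n + cnj (?G t * cnj (cis t ^ n)) - cis t ^ n)"
    by (intro Bochner_Integration.integral_cong refl) (simp add: poisson_kernel_geometric[OF r] algebra_simps)
  also have "\<dots> = integral\<^sup>L angle_measure (\<lambda>t. ?G t * cis t ^ n)
      + cnj (integral\<^sup>L angle_measure (\<lambda>t. ?G t * cnj (cis t ^ n))) - integral\<^sup>L angle_measure (\<lambda>t. cis t ^ n * cis t ^ 0)"
    using Bochner_Integration.integral_diff[OF Bochner_Integration.integrable_add[OF i(1)
        integrable_cnj[OF i(2)]] i(3)] Bochner_Integration.integral_add[OF i(1) integrable_cnj[OF i(2)]]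
    by (simp only: Bochner_Integration.integral_cnj power_0 mult_1_right)
  also have "\<dots> = of_real (r ^ n)"
    unfolding mean_circle_series_power[OF c] mean_circle_series_cnj_power[OF c] mean_cis_mult by simp
  finally show ?thesis .
qed

text \<open>Translation by \<open>\<theta>\<close> multiplies the \<open>n\<close>-th coefficient by \<open>e^(in\<theta>)\<close>, and the kernel has \<open>n\<close>-th
  Fourier coefficient \<open>r ^ n\<close>; integrate term by term.\<close>

lemma poisson_representation:
  assumes c: "summable (\<lambda>n. norm (c n))" and r: "0 \<le> r" "r < 1"
  shows "circle_series (\<lambda>n. c n * of_real (r ^ n)) \<theta>
       = integral\<^sup>L angle_measure (\<lambda>t. of_real (poisson_kernel r t) * circle_series c (\<theta> + t))"
proof -
  let ?d = "\<lambda>n. c n * cis \<theta> ^ n"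
  obtain B where B: "norm (poisson_kernel r t) \<le> B" for t using poisson_kernel_bound[OF r] by blast
  have d: "summable (\<lambda>n. norm (?d n))" by (rule circle_series_summable[OF c])
  have P: "continuous_on UNIV (\<lambda>t. complex_of_real (poisson_kernel r t))"
    by (intro continuous_intros poisson_kernel_continuous[OF r])
  have PB: "norm (complex_of_real (poisson_kernel r t)) \<le> B" for t using B[of t] by simp
  have shift: "circle_series ?d t = circle_series c (\<theta> + t)" for t
    unfolding circle_series_def cis_mult[symmetric] power_mult_distrib by (simp only: mult.assoc)
  have "(\<lambda>n. ?d n * of_real (r ^ n)) sums
      integral\<^sup>L angle_measure (\<lambda>t. circle_series ?d t * of_real (poisson_kernel r t))"
    using mean_circle_series_mult[OF d P PB] unfolding mean_poisson_kernel_power[OF r] .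
  moreover have "(\<lambda>n. ?d n * of_real (r ^ n)) = (\<lambda>n. c n * of_real (r ^ n) * cis \<theta> ^ n)"
    by (simp add: fun_eq_iff)
  ultimately show ?thesis
    unfolding shift by (simp add: circle_series_def sums_iff mult.commute)
qed

section \<open>A maximal inequality for translates\<close>

lemma antiderivative_on_line:
  fixes f :: "real \<Rightarrow> 'a :: euclidean_space"
  assumes "continuous_on UNIV f"
  obtains F where "\<And>x. (F has_vector_derivative f x) (at x)"
proof -
  have "\<exists>F. \<forall>x::real. - \<infinity> < ereal x \<longrightarrow> ereal x < \<infinity> \<longrightarrow> (F has_vector_derivative f x) (at x)"
    by (rule einterval_antiderivative) (use assms in \<open>auto simp: continuous_on_eq_continuous_at\<close>)
  then show ?thesis using that by auto
qed

lemma mean_derivative: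
  fixes F :: "real \<Rightarrow> real"
  assumes "continuous_on UNIV f" "\<And>x. (F has_vector_derivative f x) (at x)"
  shows "integral\<^sup>L angle_measure f = (F (2 * pi) - F 0) / (2 * pi)"
proof -
  have "(f has_integral (F (2 * pi) - F 0)) {0..2 * pi}"
    by (rule fundamental_theorem_of_calculus)
      (auto intro: assms(2) has_vector_derivative_at_within)
  then show ?thesis using assms(1) by (simp add: integral_angle integral_unique)
qed

text \<open>For a primitive \<open>G\<close> of \<open>N\<close>, the function \<open>G(s + 2\<pi>) - G(s)\<close> has the constant derivative \<open>c\<close>. With
  \<open>c = 0\<close> this is invariance of the mean of a periodic function under rotation.\<close>

lemma mean_translate_diff:
  fixes N :: "real \<Rightarrow> real"
  assumes N: "continuous_on UNIV N" and per: "\<And>x. N (x + 2 * pi) = N x + c"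
  shows "integral\<^sup>L angle_measure (\<lambda>x. N (x + d) - N x) = c * d / (2 * pi)"
proof -
  obtain G where G: "\<And>x. (G has_vector_derivative N x) (at x)"
    using antiderivative_on_line[OF N] by blast
  have Gs: "((\<lambda>x. G (x + s)) has_vector_derivative N (x + s)) (at x)" for x s
    using G[of "x + s"] by (simp add: DERIV_shift flip: has_real_derivative_iff_has_vector_derivative)
  define D where "D s = G (s + 2 * pi) - G s - c * s" for s
  have "(D has_real_derivative 0) (at s)" for s
    unfolding D_def[abs_def]
    using Gs[of "2 * pi" s] G[of s]
    by (auto simp: per simp flip: has_real_derivative_iff_has_vector_derivative
        intro!: derivative_eq_intros)
  then have D: "D d = D 0" using DERIV_isconst_all by blast
  have "integral\<^sup>L angle_measure (\<lambda>x. N (x + d) - N x)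
      = ((G (2 * pi + d) - G (2 * pi)) - (G (0 + d) - G 0)) / (2 * pi)"
    by (rule mean_derivative)
      (intro continuous_intros continuous_on_compose2[OF N], auto intro!: has_vector_derivative_diff Gs G)
  also have "(G (2 * pi + d) - G (2 * pi)) - (G (0 + d) - G 0) = c * d"
    using D by (simp add: D_def add.commute)
  finally show ?thesis .
qed

lemma mean_translate:
  fixes N :: "real \<Rightarrow> real"
  assumes N: "continuous_on UNIV N" and per: "\<And>x. N (x + 2 * pi) = N x"
  shows "integral\<^sup>L angle_measure (\<lambda>x. N (x + d)) = integral\<^sup>L angle_measure N"
proof -
  have "continuous_on UNIV (\<lambda>x. N (x + d))"
    by (intro continuous_on_compose2[OF N] continuous_intros) auto
  then have "integral\<^sup>L angle_measure (\<lambda>x. N (x + d)) - integral\<^sup>L angle_measure N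
      = integral\<^sup>L angle_measure (\<lambda>x. N (x + d) - N x)"
    by (intro Bochner_Integration.integral_diff[symmetric] integrable_angle N)
  also have "\<dots> = 0" using mean_translate_diff[OF N, of 0 d] per by simp
  finally show ?thesis by simp
qed

text \<open>The maximum of \<open>0\<close> and the partial sums \<open>\<phi>(x) + \<phi>(x + d) + \<dots> + \<phi>(x + (k - 1) d)\<close> for \<open>k \<le> n\<close>. The
  recursion, which splits off the first term of the orbit, is the form used by Garsia's argument.\<close>

fun orbit_max :: "real \<Rightarrow> (real \<Rightarrow> real) \<Rightarrow> nat \<Rightarrow> real \<Rightarrow> real" where
  "orbit_max d \<phi> 0 x = 0"
| "orbit_max d \<phi> (Suc n) x = max 0 (\<phi> x + orbit_max d \<phi> n (x + d))"

lemma orbit_max_continuous: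
  assumes "continuous_on UNIV \<phi>"
  shows "continuous_on UNIV (orbit_max d \<phi> n)"
proof (induction n)
  case 0
  have "orbit_max d \<phi> 0 = (\<lambda>_. 0)" by auto
  then show ?case by simp
next
  case (Suc n)
  have "orbit_max d \<phi> (Suc n) = (\<lambda>x. max 0 (\<phi> x + orbit_max d \<phi> n (x + d)))" by auto
  moreover have "continuous_on UNIV (\<lambda>x. orbit_max d \<phi> n (x + d))"
    by (rule continuous_on_compose2[OF Suc]) (auto intro!: continuous_intros)
  ultimately show ?case
    using assms by (auto intro!: continuous_intros)
qed

lemma orbit_max_periodic:
  assumes "\<And>x. \<phi> (x + p) = \<phi> x"
  shows "orbit_max d \<phi> n (x + p) = orbit_max d \<phi> n x"
proof (induction n arbitrary: x)
  case (Suc n)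
  have "orbit_max d \<phi> n (x + p + d) = orbit_max d \<phi> n (x + d)"
    using Suc[of "x + d"] by (simp add: algebra_simps)
  then show ?case by (simp add: assms)
qed simp

lemma orbit_max_nonneg: "0 \<le> orbit_max d \<phi> n x"
  by (cases n) auto

lemma orbit_max_mono: "orbit_max d \<phi> n x \<le> orbit_max d \<phi> (Suc n) x"
proof (induction n arbitrary: x)
  case (Suc n)
  have "max 0 (\<phi> x + orbit_max d \<phi> n (x + d)) \<le> max 0 (\<phi> x + orbit_max d \<phi> (Suc n) (x + d))"
    using Suc[of "x + d"] by (intro max.mono) auto
  then show ?case by simp
qed simp

lemma orbit_sum_le_max:
  assumes "k \<le> n"
  shows "(\<Sum>i<k. \<phi> (x + of_nat i * d)) \<le> orbit_max d \<phi> n x"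
  using assms
proof (induction n arbitrary: k x)
  case (Suc n)
  show ?case
  proof (cases k)
    case (Suc j)
    then have "(\<Sum>i<k. \<phi> (x + of_nat i * d)) = \<phi> x + (\<Sum>i<j. \<phi> (x + d + of_nat i * d))"
      by (simp only: sum.lessThan_Suc_shift) (simp add: algebra_simps)
    also have "\<dots> \<le> \<phi> x + orbit_max d \<phi> n (x + d)"
      using Suc.IH[of j "x + d"] Suc.prems Suc by simp
    finally show ?thesis by simp
  qed (simp add: orbit_max_nonneg del: orbit_max.simps)
qed simp

text \<open>Garsia's proof of the maximal ergodic theorem, for the rotation by \<open>d = \<sigma> \<delta>\<close>. Let \<open>q\<close> be the increment
  of \<open>A\<close> over one step and \<open>\<phi> = q - l \<delta>\<close>; the partial sums of \<open>\<phi>\<close> along an orbit telescope, so that the set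
  in question lies in \<open>{M > 0}\<close> for \<open>M = orbit_max d \<phi> n\<close>. Where \<open>M(x) > 0\<close>, the recursion and
  monotonicity in \<open>n\<close> give \<open>M(x) \<le> \<phi>(x) + M(x + d)\<close>; elsewhere \<open>M(x) = 0 \<le> M(x + d)\<close>. Both cases say that
  \<open>l \<delta> 1_{M > 0} \<le> q + M(x + d) - M(x)\<close>. The last two terms cancel in the mean, and \<open>q\<close> has mean
  \<open>c \<delta> / (2\<pi>)\<close>. The sign \<open>\<sigma>\<close> selects averages to the right or to the left.\<close>

lemma discrete_maximal_inequality:
  fixes A :: "real \<Rightarrow> real"
  assumes A: "continuous_on UNIV A" and mono: "mono A" and per: "\<And>x. A (x + 2 * pi) = A x + c"
    and \<sigma>: "\<sigma> = 1 \<or> \<sigma> = -1" and \<delta>: "0 < \<delta>" and l: "0 < l"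
  shows "measure angle_measure {x. \<exists>k\<le>n. l * (of_nat k * \<delta>) < \<sigma> * (A (x + \<sigma> * (of_nat k * \<delta>)) - A x)}
      \<le> c / (2 * pi * l)" (is "measure _ ?E \<le> _")
proof -
  define d where "d = \<sigma> * \<delta>"
  define q where "q x = \<sigma> * (A (x + d) - A x)" for x
  define \<phi> where "\<phi> x = q x - l * \<delta>" for x
  define M where "M = orbit_max d \<phi> n"
  have q: "0 \<le> q x" for x
    using \<sigma> \<delta> mono by (auto simp: q_def d_def mono_def)
  have cont_q: "continuous_on UNIV q"
    unfolding q_def by (intro continuous_intros continuous_on_compose2[OF A]) auto
  have cont: "continuous_on UNIV \<phi>"
    unfolding \<phi>_def by (intro continuous_intros cont_q)
  have "\<phi> (x + 2 * pi) = \<phi> x" for x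
    using per[of "x + d"] by (simp add: \<phi>_def q_def per add_ac)
  then have perM: "M (x + 2 * pi) = M x" for x
    by (simp add: M_def orbit_max_periodic)
  have contM: "continuous_on UNIV M"
    unfolding M_def by (rule orbit_max_continuous[OF cont])
  have contMd: "continuous_on UNIV (\<lambda>x. M (x + d))"
    by (rule continuous_on_compose2[OF contM]) (auto intro!: continuous_intros)
  let ?P = "{x. 0 < M x}"
  have P: "?P \<in> sets borel"
    by (intro borel_open open_Collect_less contM continuous_intros)
  have telescope: "(\<Sum>i<k. \<phi> (x + of_nat i * d))
      = \<sigma> * (A (x + \<sigma> * (of_nat k * \<delta>)) - A x) - l * (of_nat k * \<delta>)" for k x
    by (induction k) (simp_all add: \<phi>_def q_def d_def algebra_simps)
  have sub: "?E \<subseteq> ?P"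
  proof
    fix x assume "x \<in> ?E"
    then obtain k where "k \<le> n" "0 < (\<Sum>i<k. \<phi> (x + of_nat i * d))"
      by (auto simp: telescope)
    then show "x \<in> ?P"
      using orbit_sum_le_max[of k n \<phi> x d] by (simp add: M_def)
  qed
  have key: "l * \<delta> * indicator ?P x - (M (x + d) - M x) \<le> q x" for x
  proof (cases "0 < M x")
    case True
    have "M x \<le> orbit_max d \<phi> (Suc n) x"
      unfolding M_def by (rule orbit_max_mono)
    with True have "M x \<le> \<phi> x + M (x + d)"
      by (auto simp: M_def)
    with True show ?thesis by (simp add: \<phi>_def)
  next
    case False
    then have "M x = 0" "0 \<le> M (x + d)"
      using orbit_max_nonneg[of d \<phi> n] by (auto simp: M_def not_less intro: antisym)
    with False q[of x] show ?thesis by simp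
  qed
  have ind: "integrable angle_measure (indicator ?P :: real \<Rightarrow> real)"
    using P by (intro integrable_real_indicator) (auto simp: angle.emeasure_eq_measure)
  have iM: "integrable angle_measure (\<lambda>x. M (x + d) - M x)"
    by (intro integrable_angle continuous_intros contM contMd)
  have "l * \<delta> * measure angle_measure ?P
      = integral\<^sup>L angle_measure (\<lambda>x. l * \<delta> * indicator ?P x - (M (x + d) - M x))"
    using mean_translate_diff[OF contM, of 0 d] perM P ind iM by simp
  also have "\<dots> \<le> integral\<^sup>L angle_measure q"
    by (intro integral_mono key integrable_angle cont_q Bochner_Integration.integrable_diff iM
        integrable_mult_right ind)
  also have "\<dots> = \<sigma> * (c * d / (2 * pi))"
    unfolding q_def using mean_translate_diff[OF A per, of d] by simp
  also have "\<dots> = \<delta> * (c / (2 * pi))"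
    using \<sigma> by (auto simp: d_def)
  finally have "l * measure angle_measure ?P \<le> c / (2 * pi)"
    using \<delta> by (simp only: mult.assoc mult.left_commute[of l] mult_le_cancel_left_pos)
  moreover have "measure angle_measure ?E \<le> measure angle_measure ?P"
    by (rule angle.finite_measure_mono[OF sub]) (use P in simp)
  then have "l * measure angle_measure ?E \<le> l * measure angle_measure ?P"
    using l by simp
  ultimately have "measure angle_measure ?E * l \<le> c / (2 * pi)" by (simp add: mult.commute)
  then have "measure angle_measure ?E \<le> c / (2 * pi) / l"
    using l by (simp only: pos_le_divide_eq)
  then show ?thesis by simp
qed

text \<open>For \<open>A\<close> a primitive of \<open>f \<ge> 0\<close>, this bounds the measure of the set where some average of \<open>f\<close> over an
  interval that begins (or ends) at \<open>x\<close> exceeds \<open>l\<close>. By continuity of \<open>A\<close> the length of the interval may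
  be taken to be a dyadic fraction of \<open>\<pi>\<close>, and dyadic refinement makes the discrete sets increase.\<close>

lemma maximal_inequality:
  fixes A :: "real \<Rightarrow> real"
  assumes A: "continuous_on UNIV A" and mono: "mono A" and per: "\<And>x. A (x + 2 * pi) = A x + c"
    and \<sigma>: "\<sigma> = 1 \<or> \<sigma> = -1" and l: "0 < l"
  shows "open {x. \<exists>h\<in>{0<..pi}. l * h < \<sigma> * (A (x + \<sigma> * h) - A x)}" (is "open ?E")
    and "measure angle_measure {x. \<exists>h\<in>{0<..pi}. l * h < \<sigma> * (A (x + \<sigma> * h) - A x)} \<le> c / (2 * pi * l)"
proof -
  have cx: "continuous_on UNIV (\<lambda>x. \<sigma> * (A (x + s) - A x))" for s
    by (intro continuous_intros continuous_on_compose2[OF A]) auto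
  have "open (\<Union>h\<in>{0<..pi}. {x. l * h < \<sigma> * (A (x + \<sigma> * h) - A x)})"
    by (intro open_UN ballI open_Collect_less cx continuous_intros)
  moreover have "(\<Union>h\<in>{0<..pi}. {x. l * h < \<sigma> * (A (x + \<sigma> * h) - A x)}) = ?E" by auto
  ultimately show op: "open ?E" by simp
  define F where "F m = {x. \<exists>k\<le>(2::nat) ^ m. l * (of_nat k * (pi / 2 ^ m))
      < \<sigma> * (A (x + \<sigma> * (of_nat k * (pi / 2 ^ m))) - A x)}" for m
  have Fopen: "open (F m)" for m
  proof -
    have "open (\<Union>k\<in>{..(2::nat) ^ m}. {x. l * (of_nat k * (pi / 2 ^ m))
      < \<sigma> * (A (x + \<sigma> * (of_nat k * (pi / 2 ^ m))) - A x)})"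
      by (intro open_UN ballI open_Collect_less cx continuous_intros)
    moreover have "(\<Union>k\<in>{..(2::nat) ^ m}. {x. l * (of_nat k * (pi / 2 ^ m))
      < \<sigma> * (A (x + \<sigma> * (of_nat k * (pi / 2 ^ m))) - A x)}) = F m" by (auto simp: F_def)
    ultimately show ?thesis by simp
  qed
  have Finc: "incseq F"
  proof (rule incseq_SucI, rule subsetI)
    fix m x assume "x \<in> F m"
    then obtain k where k: "k \<le> 2 ^ m"
      "l * (of_nat k * (pi / 2 ^ m)) < \<sigma> * (A (x + \<sigma> * (of_nat k * (pi / 2 ^ m))) - A x)"
      by (auto simp: F_def)
    have e: "real (2 * k) * (pi / 2 ^ Suc m) = real k * (pi / 2 ^ m)" by simp
    show "x \<in> F (Suc m)"
      unfolding F_def by (intro CollectI exI[of _ "2 * k"], unfold e) (use k in simp)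
  qed
  have sub: "?E \<subseteq> (\<Union>m. F m)"
  proof
    fix x assume "x \<in> ?E"
    then obtain h where h: "0 < h" "h \<le> pi" and less: "l * h < \<sigma> * (A (x + \<sigma> * h) - A x)" by auto
    define g where "g h = \<sigma> * (A (x + \<sigma> * h) - A x) - l * h" for h
    have "continuous_on UNIV g"
      unfolding g_def by (intro continuous_intros continuous_on_compose2[OF A]) auto
    then have "open {h. 0 < g h}" by (intro open_Collect_less continuous_intros)
    moreover have "h \<in> {h. 0 < g h}" using less by (simp add: g_def)
    ultimately obtain e where e: "0 < e" "\<And>y. dist y h < e \<Longrightarrow> 0 < g y"
      unfolding open_dist by blast
    obtain m where m: "pi / e < 2 ^ m"
      using real_arch_pow[of 2 "pi / e"] by auto
    have small: "pi / 2 ^ m < e" using m e(1) by (simp add: field_simps)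
    \<comment> \<open>The dyadic multiple \<open>k \<pi> / 2 ^ m\<close> approximates \<open>h\<close> from below, within \<open>\<pi> / 2 ^ m < e\<close>.\<close>
    define k where "k = nat \<lfloor>h * 2 ^ m / pi\<rfloor>"
    have k: "of_nat k \<le> h * 2 ^ m / pi" "h * 2 ^ m / pi < of_nat k + 1"
      using h by (simp_all add: k_def)
    have "h * 2 ^ m / pi \<le> 2 ^ m" using h by (simp add: field_simps)
    with k(1) have "real k \<le> 2 ^ m" by linarith
    then have "real k \<le> real (2 ^ m)" by simp
    then have k2: "k \<le> 2 ^ m" by (simp only: of_nat_le_iff)
    have "of_nat k * (pi / 2 ^ m) \<le> h" "h < of_nat k * (pi / 2 ^ m) + pi / 2 ^ m"
      using k by (simp_all add: field_simps)
    then have "dist (of_nat k * (pi / 2 ^ m)) h < e"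
      using small by (simp add: dist_real_def)
    from e(2)[OF this] k2 have "x \<in> F m"
      by (auto simp: F_def g_def)
    then show "x \<in> (\<Union>m. F m)" by blast
  qed
  have "(\<lambda>m. measure angle_measure (F m)) \<longlonglongrightarrow> measure angle_measure (\<Union>m. F m)"
    using Fopen Finc by (intro angle.finite_Lim_measure_incseq) auto
  moreover have "measure angle_measure (F m) \<le> c / (2 * pi * l)" for m
    unfolding F_def by (rule discrete_maximal_inequality[OF A mono per \<sigma> _ l]) simp
  ultimately have "measure angle_measure (\<Union>m. F m) \<le> c / (2 * pi * l)"
    by (intro LIMSEQ_le_const2) auto
  moreover have "measure angle_measure ?E \<le> measure angle_measure (\<Union>m. F m)"
    by (rule angle.finite_measure_mono[OF sub]) (use Fopen in auto)
  ultimately show "measure angle_measure ?E \<le> c / (2 * pi * l)" by linarith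
qed

section \<open>Radial maximal functions\<close>

lemma poisson_kernel_deriv:
  assumes r: "0 \<le> r" "r < 1"
  shows "(poisson_kernel r has_real_derivative
     - ((1 - r\<^sup>2) * (2 * r * sin t)) / (1 - 2 * r * cos t + r\<^sup>2)\<^sup>2) (at t)"
  unfolding poisson_kernel_def[abs_def]
  using poisson_denom_pos[OF r, of t]
  by (auto intro!: derivative_eq_intros simp: power2_eq_square)

text \<open>Let \<open>B(t) = A(x + t) - A(x) - l t\<close>. The hypotheses say that \<open>B \<le> 0\<close> for \<open>t > 0\<close> and \<open>B \<ge> 0\<close> for
  \<open>t < 0\<close>, while the kernel \<open>P\<close> decreases away from \<open>0\<close>; hence \<open>P' B \<ge> 0\<close> on \<open>[-\<pi>, \<pi>]\<close>, and
  \<open>P (f(x + t) - l) = P B' \<le> (P B)'\<close>. The integral of the right-hand side is at most \<open>0\<close>, by the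
  signs of \<open>B\<close> at the two ends.\<close>

lemma poisson_mean_le:
  fixes f A :: "real \<Rightarrow> real"
  assumes f: "continuous_on UNIV f" and per: "\<And>x. f (x + 2 * pi) = f x"
    and A: "\<And>x. (A has_vector_derivative f x) (at x)" and r: "0 \<le> r" "r < 1"
    and right: "\<And>h. h \<in> {0<..pi} \<Longrightarrow> A (x + h) - A x \<le> l * h"
    and left: "\<And>h. h \<in> {0<..pi} \<Longrightarrow> A x - A (x - h) \<le> l * h"
  shows "integral\<^sup>L angle_measure (\<lambda>t. poisson_kernel r t * f (x + t)) \<le> l"
proof -
  let ?P = "poisson_kernel r"
  define P' where "P' t = - ((1 - r\<^sup>2) * (2 * r * sin t)) / (1 - 2 * r * cos t + r\<^sup>2)\<^sup>2" for t
  define B where "B t = A (x + t) - A x - l * t" for t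
  define K where "K t = ?P t * B t" for t
  have P': "(?P has_real_derivative P' t) (at t)" for t
    unfolding P'_def by (rule poisson_kernel_deriv[OF r])
  have r2: "0 \<le> 1 - r\<^sup>2" using r by (simp add: power_le_one)
  have As: "((\<lambda>t. A (x + t)) has_real_derivative f (x + t)) (at t)" for t
    using A[of "t + x"] by (simp add: DERIV_shift add.commute flip: has_real_derivative_iff_has_vector_derivative)
  have B: "(B has_real_derivative f (x + t) - l) (at t)" for t
    unfolding B_def[abs_def] by (auto intro!: derivative_eq_intros As)
  define k where "k t = P' t * B t + (f (x + t) - l) * ?P t" for t
  have K: "(K has_real_derivative k t) (at t)" for t
    unfolding K_def[abs_def] k_def by (rule DERIV_mult[OF P' B])
  have contf: "continuous_on UNIV (\<lambda>t. f (x + t))"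
    by (rule continuous_on_compose2[OF f]) (auto intro!: continuous_intros)
  have contP: "continuous_on UNIV ?P" by (rule poisson_kernel_continuous[OF r])
  have contB: "continuous_on UNIV B"
    using B by (meson DERIV_isCont continuous_at_imp_continuous_on)
  have contP': "continuous_on UNIV P'"
    unfolding P'_def using poisson_denom_pos[OF r]
    by (intro continuous_intros ballI) (metis less_irrefl power_eq_0_iff)
  have contk: "continuous_on UNIV k"
    unfolding k_def by (intro continuous_intros contP' contB contf contP)
  have sgn: "0 \<le> P' t * B t" if t: "t \<in> {-pi..pi}" for t
  proof (cases "0 \<le> t")
    case True
    then have "0 \<le> sin t" using t by (intro sin_ge_zero) auto
    then have "P' t \<le> 0" unfolding P'_def using r r2
      by (intro divide_nonpos_nonneg) (auto intro!: mult_nonneg_nonneg)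
    moreover have "B t \<le> 0"
      using right[of t] True t by (cases "t = 0") (auto simp: B_def)
    ultimately show ?thesis by (rule mult_nonpos_nonpos)
  next
    case False
    then have "0 \<le> sin (- t)" using t by (intro sin_ge_zero) auto
    then have "0 \<le> - sin t" by simp
    then have "0 \<le> (1 - r\<^sup>2) * (2 * r * - sin t)" using r r2
      by (intro mult_nonneg_nonneg) auto
    then have "0 \<le> P' t" unfolding P'_def
      by (intro divide_nonneg_nonneg) auto
    moreover have "0 \<le> B t"
      using left[of "- t"] False t by (auto simp: B_def)
    ultimately show ?thesis by (rule mult_nonneg_nonneg)
  qed
  have ends: "K pi \<le> 0" "0 \<le> K (- pi)"
  proof -
    have "B pi \<le> 0" "0 \<le> B (- pi)"
      using right[of pi] left[of pi] by (simp_all add: B_def)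
    then show "K pi \<le> 0" "0 \<le> K (- pi)"
      unfolding K_def using poisson_kernel_nonneg[OF r]
      by (auto intro: mult_nonneg_nonneg mult_nonneg_nonpos)
  qed
  define g where "g t = ?P t * (f (x + t) - l)" for t
  have contg: "continuous_on UNIV g"
    unfolding g_def by (intro continuous_intros contf contP)
  \<comment> \<open>The mean is over \<open>[0, 2\<pi>]\<close>, but the kernel is unimodal on \<open>[-\<pi>, \<pi>]\<close>.\<close>
  have "integral\<^sup>L angle_measure g = integral\<^sup>L angle_measure (\<lambda>t. g (t + - pi))"
  proof (rule mean_translate[OF contg, symmetric])
    show "g (t + 2 * pi) = g t" for t
      using per[of "x + t"] by (simp add: g_def poisson_kernel_def add.assoc[symmetric])
  qed
  also have "\<dots> \<le> integral\<^sup>L angle_measure (\<lambda>t. k (t + - pi))"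
  proof (rule integral_mono_AE)
    show "integrable angle_measure (\<lambda>t. g (t + - pi))" "integrable angle_measure (\<lambda>t. k (t + - pi))"
      by (intro integrable_angle continuous_on_compose2[OF contg] continuous_on_compose2[OF contk]
          continuous_intros; auto)+
    have "g (t + - pi) \<le> k (t + - pi)" if "t \<in> {0..<2 * pi}" for t
      using sgn[of "t + - pi"] that by (simp add: g_def k_def mult.commute)
    then show "AE t in angle_measure. g (t + - pi) \<le> k (t + - pi)"
      unfolding angle_measure_def by (intro AE_uniform_measureI) auto
  qed
  also have "\<dots> = (K (2 * pi + - pi) - K (0 + - pi)) / (2 * pi)"
  proof (rule mean_derivative)
    show "continuous_on UNIV (\<lambda>t. k (t + - pi))"
      by (rule continuous_on_compose2[OF contk]) (auto intro!: continuous_intros)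
    show "((\<lambda>t. K (t + - pi)) has_vector_derivative k (t + - pi)) (at t)" for t
      using K[of "t + - pi"] unfolding has_real_derivative_iff_has_vector_derivative[symmetric]
      by (simp only: DERIV_shift)
  qed
  also have "\<dots> \<le> 0"
    using ends by (intro divide_nonpos_nonneg) auto
  finally have "integral\<^sup>L angle_measure g \<le> 0" .
  moreover have "integral\<^sup>L angle_measure g
      = integral\<^sup>L angle_measure (\<lambda>t. ?P t * f (x + t)) - l * integral\<^sup>L angle_measure ?P"
  proof -
    have "integrable angle_measure (\<lambda>t. ?P t * f (x + t))" "integrable angle_measure ?P"
      by (intro integrable_angle continuous_intros contP contf)+
    then have "integral\<^sup>L angle_measure (\<lambda>t. ?P t * f (x + t) - l * ?P t)
      = integral\<^sup>L angle_measure (\<lambda>t. ?P t * f (x + t)) - l * integral\<^sup>L angle_measure ?P"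
      by simp
    then show ?thesis by (simp add: g_def[abs_def] algebra_simps)
  qed
  moreover have "integral\<^sup>L angle_measure ?P = 1"
  proof -
    have "complex_of_real (integral\<^sup>L angle_measure ?P) = of_real 1"
      using mean_poisson_kernel_power[OF r, of 0] by simp
    then show ?thesis by (simp only: of_real_eq_iff)
  qed
  ultimately show ?thesis by simp
qed

text \<open>If all averages of the modulus over arcs that begin or end at \<open>\<theta>\<close> are at most \<open>l\<close>, then so is the
  Poisson integral, and with it the series on the whole radius.\<close>

lemma radial_maximal_inequality_L1:
  assumes c: "summable (\<lambda>n. norm (c n))" and l: "0 < l"
  shows "measure angle_measure
      {\<theta>. \<exists>r\<in>{0..<1}. l < norm (circle_series (\<lambda>n. c n * of_real (r ^ n)) \<theta>)}
    \<le> 2 * integral\<^sup>L angle_measure (\<lambda>\<theta>. norm (circle_series c \<theta>)) / l"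
proof -
  define f where "f \<theta> = norm (circle_series c \<theta>)" for \<theta>
  have f: "continuous_on UNIV f"
    unfolding f_def by (intro continuous_intros circle_series_continuous[OF c])
  have per: "f (x + 2 * pi) = f x" for x
    by (simp add: f_def circle_series_def cis_mult[symmetric])
  obtain A where A: "\<And>x. (A has_vector_derivative f x) (at x)"
    using antiderivative_on_line[OF f] by blast
  then have A': "(A has_real_derivative f x) (at x)" for x
    by (simp add: has_real_derivative_iff_has_vector_derivative)
  have contA: "continuous_on UNIV A"
    using A' by (meson DERIV_isCont continuous_at_imp_continuous_on)
  have mono: "mono A"
  proof (rule monoI)
    fix x y :: real assume "x \<le> y"
    then show "A x \<le> A y"
    proof (rule DERIV_nonneg_imp_nondecreasing)
      show "\<exists>d. (A has_real_derivative d) (at z) \<and> 0 \<le> d" for z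
        using A'[of z] by (intro exI[of _ "f z"]) (simp add: f_def)
    qed
  qed
  define C where "C = 2 * pi * integral\<^sup>L angle_measure f"
  have perA: "A (x + 2 * pi) = A x + C" for x
  proof -
    have "((\<lambda>x. A (x + 2 * pi) - A x) has_real_derivative 0) (at y)" for y
    proof -
      have "((\<lambda>x. A (x + 2 * pi)) has_real_derivative f y) (at y)"
        using A'[of "y + 2 * pi"] by (simp only: DERIV_shift per)
      from DERIV_diff[OF this A'[of y]] show ?thesis by simp
    qed
    then have "A (x + 2 * pi) - A x = A (0 + 2 * pi) - A 0" using DERIV_isconst_all by blast
    moreover have "A (2 * pi) - A 0 = C"
      using mean_derivative[OF f A] by (simp add: C_def)
    ultimately show ?thesis by simp
  qed
  let ?E = "\<lambda>\<sigma>. {x. \<exists>h\<in>{0<..pi}. l * h < \<sigma> * (A (x + \<sigma> * h) - A x)}"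
  note max = maximal_inequality[OF contA mono perA _ l]
  have sub: "{\<theta>. \<exists>r\<in>{0..<1}. l < norm (circle_series (\<lambda>n. c n * of_real (r ^ n)) \<theta>)} \<subseteq> ?E 1 \<union> ?E (-1)"
    (is "?S \<subseteq> _")
  proof (rule subsetI, rule ccontr)
    fix x assume x: "x \<in> ?S" "x \<notin> ?E 1 \<union> ?E (-1)"
    then obtain r where r: "0 \<le> r" "r < 1" "l < norm (circle_series (\<lambda>n. c n * of_real (r ^ n)) x)" by auto
    have "norm (circle_series (\<lambda>n. c n * of_real (r ^ n)) x)
        \<le> integral\<^sup>L angle_measure (\<lambda>t. norm (of_real (poisson_kernel r t) * circle_series c (x + t)))"
      unfolding poisson_representation[OF c r(1,2)] by (rule integral_norm_bound)
    also have "\<dots> = integral\<^sup>L angle_measure (\<lambda>t. poisson_kernel r t * f (x + t))"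
      using poisson_kernel_nonneg[OF r(1,2)] by (simp add: f_def norm_mult)
    also have "\<dots> \<le> l"
    proof (rule poisson_mean_le[OF f per A r(1,2)])
      show "A (x + h) - A x \<le> l * h" if "h \<in> {0<..pi}" for h
        using x(2) that by (auto simp: not_less)
      show "A x - A (x - h) \<le> l * h" if "h \<in> {0<..pi}" for h
        using x(2) that by (auto simp: not_less)
    qed
    finally show False using r(3) by simp
  qed
  have sets: "?E 1 \<in> sets angle_measure" "?E (-1) \<in> sets angle_measure"
    using max(1)[of 1] max(1)[of "-1"] by auto
  have "measure angle_measure ?S \<le> measure angle_measure (?E 1 \<union> ?E (-1))"
    by (rule angle.finite_measure_mono[OF sub]) (use sets in blast)
  also have "\<dots> \<le> measure angle_measure (?E 1) + measure angle_measure (?E (-1))"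
    by (rule measure_Un_le[OF sets])
  also have "\<dots> \<le> C / (2 * pi * l) + C / (2 * pi * l)"
    by (intro add_mono max(2)) auto
  also have "\<dots> = 2 * integral\<^sup>L angle_measure f / l" by (simp add: C_def)
  finally show ?thesis by (simp add: f_def[abs_def])
qed

section \<open>Radial limits of square-summable power series\<close>

lemma radial_maximal_set_open:
  assumes "\<And>r. r \<in> I \<Longrightarrow> summable (\<lambda>n. norm (a n * of_real (r ^ n) :: complex))"
  shows "open {\<theta>. \<exists>r\<in>I. l < norm (circle_series (\<lambda>n. a n * of_real (r ^ n)) \<theta>)}"
proof -
  have "open (\<Union>r\<in>I. {\<theta>. l < norm (circle_series (\<lambda>n. a n * of_real (r ^ n)) \<theta>)})"
    by (intro open_UN ballI open_Collect_less continuous_intros circle_series_continuous assms)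
  moreover have "(\<Union>r\<in>I. {\<theta>. l < norm (circle_series (\<lambda>n. a n * of_real (r ^ n)) \<theta>)})
      = {\<theta>. \<exists>r\<in>I. l < norm (circle_series (\<lambda>n. a n * of_real (r ^ n)) \<theta>)}" by auto
  ultimately show ?thesis by simp
qed

text \<open>The Cauchy-Schwarz inequality against the constant \<open>1\<close>, in the form \<open>2 e |f| \<le> e\<^sup>2 + |f|\<^sup>2\<close>.\<close>

lemma mean_norm_circle_series_le:
  assumes c: "summable (\<lambda>n. norm (c n))" and e: "0 < e" and le: "(\<Sum>n. (norm (c n))\<^sup>2) \<le> e\<^sup>2"
  shows "integral\<^sup>L angle_measure (\<lambda>\<theta>. norm (circle_series c \<theta>)) \<le> e"
proof -
  note cont = circle_series_continuous[OF c]
  let ?f = "\<lambda>\<theta>. norm (circle_series c \<theta>)"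
  have i: "integrable angle_measure ?f" "integrable angle_measure (\<lambda>\<theta>. (?f \<theta>)\<^sup>2)"
    by (intro integrable_angle continuous_intros cont)+
  have i2: "integrable angle_measure (\<lambda>\<theta>. 2 * e * ?f \<theta>)"
    "integrable angle_measure (\<lambda>\<theta>. e\<^sup>2 + (?f \<theta>)\<^sup>2)"
    by (intro integrable_angle continuous_intros cont)+
  have "2 * e * integral\<^sup>L angle_measure ?f = integral\<^sup>L angle_measure (\<lambda>\<theta>. 2 * e * ?f \<theta>)"
    by simp
  also have "\<dots> \<le> integral\<^sup>L angle_measure (\<lambda>\<theta>. e\<^sup>2 + (?f \<theta>)\<^sup>2)"
  proof (rule integral_mono[OF i2])
    show "2 * e * ?f \<theta> \<le> e\<^sup>2 + (?f \<theta>)\<^sup>2" for \<theta>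
      using sum_squares_bound[of e "?f \<theta>"] by simp
  qed
  also have "\<dots> = e\<^sup>2 + integral\<^sup>L angle_measure (\<lambda>\<theta>. (?f \<theta>)\<^sup>2)"
    using i(2) angle.prob_space by simp
  also have "\<dots> \<le> e\<^sup>2 + e\<^sup>2"
    using le parseval_circle_series[OF c] by (simp add: sums_iff)
  finally have "e * (2 * integral\<^sup>L angle_measure ?f) \<le> e * (2 * e)"
    by (simp add: power2_eq_square algebra_simps)
  then show ?thesis using e by simp
qed

lemma square_summable_imp_bounded:
  fixes a :: "nat \<Rightarrow> complex"
  assumes "summable (\<lambda>n. (norm (a n))\<^sup>2)"
  obtains B where "\<And>n. norm (a n) \<le> B"
proof -
  have "bounded (range (\<lambda>n. (norm (a n))\<^sup>2))"
    using summable_LIMSEQ_zero[OF assms] convergent_imp_bounded by blast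
  then obtain C where C: "\<And>n. (norm (a n))\<^sup>2 \<le> C"
    by (auto simp: bounded_iff)
  have "norm (a n) \<le> 1 + C" for n
  proof -
    have "2 * norm (a n) \<le> 1 + (norm (a n))\<^sup>2"
      using sum_squares_bound[of 1 "norm (a n)"] by simp
    moreover have "0 \<le> (norm (a n))\<^sup>2" by simp
    ultimately show ?thesis using C[of n] by linarith
  qed
  then show ?thesis by (rule that)
qed

lemma bounded_coeffs_summable:
  fixes a :: "nat \<Rightarrow> complex"
  assumes B: "\<And>n. norm (a n) \<le> B" and r: "0 \<le> r" "r < 1"
  shows "summable (\<lambda>n. norm (a n * of_real (r ^ n)))"
proof (rule summable_comparison_test')
  show "summable (\<lambda>n. B * r ^ n)" using r by (intro summable_mult summable_geometric) simp
  show "norm (norm (a n * of_real (r ^ n))) \<le> B * r ^ n" for n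
    using B[of n] r by (simp add: norm_mult norm_power mult_right_mono)
qed

text \<open>The coefficients are now only square-summable, so the series need not converge on the unit circle.
  It is restricted to circles of radius \<open>s < 1\<close>, where the bound for absolutely summable coefficients
  applies uniformly in \<open>s\<close>, and then \<open>s\<close> increases to \<open>1\<close>.\<close>

lemma radial_maximal_inequality_L2:
  fixes a :: "nat \<Rightarrow> complex"
  assumes a: "summable (\<lambda>n. (norm (a n))\<^sup>2)" and e: "0 < e" and le: "(\<Sum>n. (norm (a n))\<^sup>2) \<le> e\<^sup>2"
    and l: "0 < l"
  shows "measure angle_measure
      {\<theta>. \<exists>r\<in>{0..<1}. l < norm (circle_series (\<lambda>n. a n * of_real (r ^ n)) \<theta>)} \<le> 2 * e / l"
proof -
  obtain B where B: "\<And>n. norm (a n) \<le> B" using square_summable_imp_bounded[OF a] by blast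
  define s where "s m = 1 - 1 / (real m + 2)" for m
  have s: "0 < s m" "s m < 1" for m by (auto simp: s_def field_simps)
  have s_mono: "s m \<le> s (Suc m)" for m by (auto simp: s_def field_simps)
  define E where "E m = {\<theta>. \<exists>r\<in>{0..<s m}. l < norm (circle_series (\<lambda>n. a n * of_real (r ^ n)) \<theta>)}" for m
  have opE: "open (E m)" for m
    unfolding E_def using s[of m] by (intro radial_maximal_set_open bounded_coeffs_summable[OF B]) auto
  have inc: "incseq E"
  proof (rule incseq_SucI)
    show "E m \<subseteq> E (Suc m)" for m using s_mono[of m] by (force simp: E_def)
  qed
  have un: "(\<Union>m. E m) = {\<theta>. \<exists>r\<in>{0..<1}. l < norm (circle_series (\<lambda>n. a n * of_real (r ^ n)) \<theta>)}"
  proof (intro equalityI subsetI)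
    fix x assume "x \<in> {\<theta>. \<exists>r\<in>{0..<1}. l < norm (circle_series (\<lambda>n. a n * of_real (r ^ n)) \<theta>)}"
    then obtain r where r: "0 \<le> r" "r < 1" "l < norm (circle_series (\<lambda>n. a n * of_real (r ^ n)) x)" by auto
    obtain m where "inverse (real (Suc m)) < 1 - r" using reals_Archimedean[of "1 - r"] r by auto
    moreover have "1 / (real m + 2) \<le> inverse (real (Suc m))" by (simp add: field_simps)
    ultimately have "r < s m" unfolding s_def by linarith
    with r have "x \<in> E m" unfolding E_def by (intro CollectI bexI[of _ r]) auto
    then show "x \<in> (\<Union>m. E m)" by blast
  next
    fix x assume "x \<in> (\<Union>m. E m)"
    then show "x \<in> {\<theta>. \<exists>r\<in>{0..<1}. l < norm (circle_series (\<lambda>n. a n * of_real (r ^ n)) \<theta>)}"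
      by (auto simp: E_def) (meson atLeastLessThan_iff less_trans s(2))
  qed
  have bd: "measure angle_measure (E m) \<le> 2 * e / l" for m
  proof -
    let ?c = "\<lambda>n. a n * of_real (s m ^ n)"
    have c: "summable (\<lambda>n. norm (?c n))"
      using s[of m] by (intro bounded_coeffs_summable[OF B]) auto
    have le1: "(norm (?c n))\<^sup>2 \<le> (norm (a n))\<^sup>2" for n
    proof (rule power_mono)
      have "s m ^ n \<le> 1" "0 \<le> s m ^ n" using s[of m] by (auto intro: power_le_one)
      then show "norm (?c n) \<le> norm (a n)" using s[of m]
        by (simp add: norm_mult norm_power mult_left_le)
    qed simp
    have "(\<Sum>n. (norm (?c n))\<^sup>2) \<le> (\<Sum>n. (norm (a n))\<^sup>2)"
      by (rule suminf_le[OF le1 _ a]) (rule sums_summable[OF parseval_circle_series[OF c]])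
    then have mean: "integral\<^sup>L angle_measure (\<lambda>\<theta>. norm (circle_series ?c \<theta>)) \<le> e"
      using le by (intro mean_norm_circle_series_le[OF c e]) simp
    have sub: "E m \<subseteq> {\<theta>. \<exists>r\<in>{0..<1}. l < norm (circle_series (\<lambda>n. ?c n * of_real (r ^ n)) \<theta>)}"
    proof
      fix x assume "x \<in> E m"
      then obtain r where r: "0 \<le> r" "r < s m" "l < norm (circle_series (\<lambda>n. a n * of_real (r ^ n)) x)"
        by (auto simp: E_def)
      have "s m ^ n * (r / s m) ^ n = r ^ n" for n
        using s(1)[of m] by (simp flip: power_mult_distrib)
      then have "?c n * of_real ((r / s m) ^ n) = a n * of_real (r ^ n)" for n
        by (metis mult.assoc of_real_mult)
      with r s[of m] show "x \<in> {\<theta>. \<exists>r\<in>{0..<1}. l < norm (circle_series (\<lambda>n. ?c n * of_real (r ^ n)) \<theta>)}"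
        by (intro CollectI bexI[of _ "r / s m"]) (simp_all only:, simp)
    qed
    have "open {\<theta>. \<exists>r\<in>{0..<1}. l < norm (circle_series (\<lambda>n. ?c n * of_real (r ^ n)) \<theta>)}"
      by (intro radial_maximal_set_open bounded_coeffs_summable[of _ "\<Sum>n. norm (?c n)"])
        (use c in \<open>auto intro: sum_le_suminf[of _ "{_}", simplified]\<close>)
    then have "measure angle_measure (E m) \<le> measure angle_measure
        {\<theta>. \<exists>r\<in>{0..<1}. l < norm (circle_series (\<lambda>n. ?c n * of_real (r ^ n)) \<theta>)}"
      by (intro angle.finite_measure_mono[OF sub]) auto
    also have "\<dots> \<le> 2 * integral\<^sup>L angle_measure (\<lambda>\<theta>. norm (circle_series ?c \<theta>)) / l"
      by (rule radial_maximal_inequality_L1[OF c l])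
    also have "\<dots> \<le> 2 * e / l" using mean l by (intro divide_right_mono mult_left_mono) auto
    finally show ?thesis .
  qed
  have "(\<lambda>m. measure angle_measure (E m)) \<longlonglongrightarrow> measure angle_measure (\<Union>m. E m)"
    using opE inc by (intro angle.finite_Lim_measure_incseq) auto
  then have "measure angle_measure (\<Union>m. E m) \<le> 2 * e / l"
    using bd by (intro LIMSEQ_le_const2) auto
  then show ?thesis by (simp only: un)
qed

text \<open>Fatou's theorem for the Hardy space \<open>H\<^sup>2\<close>. Split the series into a polynomial of degree less than \<open>N\<close> and
  a tail. The polynomial converges along every radius. The set \<open>bad k N\<close> where the tail exceeds
  \<open>1 / (k + 1)\<close> somewhere on the radius has measure tending to \<open>0\<close> as \<open>N\<close> grows. So for almost
  every \<open>\<theta>\<close> and every \<open>k\<close> some tail stays below \<open>1 / (k + 1)\<close>, which is the Cauchy property.\<close>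

theorem radial_limits_square_summable:
  fixes a :: "nat \<Rightarrow> complex"
  assumes a: "summable (\<lambda>n. (norm (a n))\<^sup>2)"
  shows "AE \<theta> in angle_measure.
    \<exists>L. ((\<lambda>r. circle_series (\<lambda>n. a n * of_real (r ^ n)) \<theta>) \<longlongrightarrow> L) (at_left 1)"
proof -
  obtain B where B: "\<And>n. norm (a n) \<le> B" using square_summable_imp_bounded[OF a] by blast
  have "0 \<le> B" using B[of 0] norm_ge_zero order_trans by blast
  define R where "R N n = (if n < N then 0 else a n)" for N n
  have RB: "norm (R N n) \<le> B" for N n using B[of n] \<open>0 \<le> B\<close> by (simp add: R_def)
  have R2: "summable (\<lambda>n. (norm (R N n))\<^sup>2)" for N
    by (rule summable_comparison_test'[OF a]) (simp add: R_def)
  have Rtail: "(\<lambda>N. \<Sum>n. (norm (R N n))\<^sup>2) \<longlonglongrightarrow> 0"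
  proof -
    have "(\<Sum>n. (norm (R N n))\<^sup>2) = (\<Sum>n. (norm (a (n + N)))\<^sup>2)" for N
      using suminf_split_initial_segment[OF R2[of N], of N] by (simp add: R_def)
    moreover have "(\<lambda>N. \<Sum>n. (norm (a (n + N)))\<^sup>2) \<longlonglongrightarrow> 0"
      by (rule suminf_exist_split2[OF a])
    ultimately show ?thesis by simp
  qed
  define bad where "bad k N = {\<theta>. \<exists>r\<in>{0..<1}.
      1 / (real k + 1) < norm (circle_series (\<lambda>n. R N n * of_real (r ^ n)) \<theta>)}" for k N
  have badopen: "open (bad k N)" for k N
    unfolding bad_def by (intro radial_maximal_set_open bounded_coeffs_summable[OF RB]) auto
  have null: "measure angle_measure (\<Inter>N. bad k N) = 0" for k
  proof (rule antisym[OF field_le_epsilon])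
    fix e :: real assume e: "0 < e"
    define e' where "e' = e / (2 * (real k + 1))"
    have e': "0 < e'" using e by (simp add: e'_def)
    have "\<forall>\<^sub>F N in sequentially. (\<Sum>n. (norm (R N n))\<^sup>2) < e'\<^sup>2"
      using e' by (intro order_tendstoD(2)[OF Rtail]) simp
    then obtain N where N: "(\<Sum>n. (norm (R N n))\<^sup>2) < e'\<^sup>2"
      by (auto simp: eventually_sequentially)
    have "measure angle_measure (\<Inter>N. bad k N) \<le> measure angle_measure (bad k N)"
      using badopen by (intro angle.finite_measure_mono) auto
    also have "\<dots> \<le> 2 * e' / (1 / (real k + 1))"
      unfolding bad_def by (rule radial_maximal_inequality_L2[OF R2 e']) (use N in auto)
    also have "\<dots> = e"
      unfolding e'_def by (simp add: field_simps)
    finally show "measure angle_measure (\<Inter>N. bad k N) \<le> 0 + e" by simp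
  qed simp
  have "AE \<theta> in angle_measure. \<theta> \<notin> (\<Inter>N. bad k N)" for k
  proof (rule AE_not_in)
    have "(\<Inter>N. bad k N) \<in> sets angle_measure"
      using badopen by (auto intro!: sets.countable_INT borel_open)
    then show "(\<Inter>N. bad k N) \<in> null_sets angle_measure"
      using null[of k] by (simp add: null_sets_def angle.emeasure_eq_measure)
  qed
  then have "AE \<theta> in angle_measure. \<forall>k. \<theta> \<notin> (\<Inter>N. bad k N)"
    by (simp add: AE_all_countable)
  then show ?thesis
  proof eventually_elim
    case (elim \<theta>)
    let ?F = "\<lambda>r. circle_series (\<lambda>n. a n * of_real (r ^ n)) \<theta>"
    \<comment> \<open>Given \<open>e\<close>, the tail contributes at most \<open>e / 4\<close> at each of two points of the radius, and the
      polynomial part at most \<open>e / 8\<close> each, close to the end of the radius.\<close>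
    have "cauchy_filter (filtermap ?F (at_left 1))"
      unfolding cauchy_filter_metric_filtermap
    proof (intro allI impI)
      fix e :: real assume e: "0 < e"
      obtain k where k: "inverse (real (Suc k)) < e / 4" using reals_Archimedean[of "e / 4"] e by auto
      obtain N where N: "\<theta> \<notin> bad k N" using elim by auto
      let ?S = "\<lambda>r. \<Sum>n<N. a n * of_real (r ^ n) * cis \<theta> ^ n"
      let ?T = "\<lambda>r. circle_series (\<lambda>n. R N n * of_real (r ^ n)) \<theta>"
      have split: "?F r = ?S r + ?T r" if r: "0 \<le> r" "r < 1" for r
      proof -
        have 1: "summable (\<lambda>n. a n * of_real (r ^ n) * cis \<theta> ^ n)"
          by (rule summable_norm_cancel[OF circle_series_summable[OF bounded_coeffs_summable[OF B r]]])
        have 2: "summable (\<lambda>n. R N n * of_real (r ^ n) * cis \<theta> ^ n)"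
          by (rule summable_norm_cancel[OF circle_series_summable[OF bounded_coeffs_summable[OF RB r]]])
        have "?F r = (\<Sum>n. a (n + N) * of_real (r ^ (n + N)) * cis \<theta> ^ (n + N)) + ?S r"
          unfolding circle_series_def by (rule suminf_split_initial_segment[OF 1])
        moreover have "?T r = (\<Sum>n. a (n + N) * of_real (r ^ (n + N)) * cis \<theta> ^ (n + N))"
          unfolding circle_series_def
          by (subst suminf_split_initial_segment[OF 2, of N]) (simp add: R_def)
        ultimately show ?thesis by simp
      qed
      have T: "norm (?T r) < e / 4" if "0 \<le> r" "r < 1" for r
      proof -
        have "norm (?T r) \<le> 1 / (real k + 1)"
          using N that by (auto simp: bad_def not_less)
        also have "\<dots> = inverse (real (Suc k))" by (simp add: inverse_eq_divide)
        finally show ?thesis using k by simp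
      qed
      have "(?S \<longlongrightarrow> ?S 1) (at_left 1)"
        by (intro tendsto_intros)
      then have ev: "\<forall>\<^sub>F r in at_left 1. dist (?S r) (?S 1) < e / 8"
        using e by (intro tendstoD) auto
      have ev2: "\<forall>\<^sub>F r in at_left (1::real). 0 \<le> r \<and> r < 1"
        unfolding eventually_at_left_field by (intro exI[of _ 0]) auto
      let ?P = "\<lambda>r. dist (?S r) (?S 1) < e / 8 \<and> 0 \<le> r \<and> r < 1"
      have "dist (?F x) (?F y) < e" if "?P x \<and> ?P y" for x y
      proof -
        have "dist (?F x) (?F y) = norm ((?S x - ?S 1) - (?S y - ?S 1) + (?T x - ?T y))"
        proof -
          have sx: "?F x = ?S x + ?T x" and sy: "?F y = ?S y + ?T y"
            using that by (blast intro: split)+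
          have "p + q - (p' + q') = (p - s) - (p' - s) + (q - q')" for p p' q q' s :: complex by simp
          from this[of "?S x" "?T x" "?S y" "?T y" "?S 1"] show ?thesis
            unfolding dist_norm sx sy by (rule arg_cong)
        qed
        also have "\<dots> \<le> (norm (?S x - ?S 1) + norm (?S y - ?S 1)) + (norm (?T x) + norm (?T y))"
          by (intro order_trans[OF norm_triangle_ineq] add_mono norm_triangle_ineq4)
        also have "\<dots> < e"
        proof -
          have "norm (?S x - ?S 1) < e / 8" "norm (?S y - ?S 1) < e / 8"
            "norm (?T x) < e / 4" "norm (?T y) < e / 4"
            using that T unfolding dist_norm by blast+
          then show ?thesis using e by linarith
        qed
        finally show ?thesis .
      qed
      then show "\<exists>P. eventually P (at_left 1) \<and> (\<forall>x y. P x \<and> P y \<longrightarrow> dist (?F x) (?F y) < e)"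
        using eventually_conj[OF ev ev2] by blast
    qed
    then have "convergent_filter (filtermap ?F (at_left 1))"
      by (rule cauchy_filter_convergent)
    then show ?case
      by (simp add: convergent_filter_iff filterlim_def)
  qed
qed

section \<open>Fourier coefficients of the boundary imaginary part\<close>

text \<open>\<open>|G|\<^sup>2 = 2 (Im G)\<^sup>2 + Re G\<^sup>2\<close>, and \<open>G\<^sup>2\<close> has mean \<open>G(0)\<^sup>2 = 0\<close>. So the bound on \<open>Im G\<close> controls the
  mean of \<open>|G|\<^sup>2\<close> on every circle of radius \<open>r < 1\<close>, hence the sum of the \<open>|a\<^sub>n|\<^sup>2 r^(2n)\<close>.\<close>

lemma square_summable_of_bounded_Im:
  fixes a :: "nat \<Rightarrow> complex"
  assumes a0: "a 0 = 0"
    and sum: "\<And>r. 0 \<le> r \<Longrightarrow> r < 1 \<Longrightarrow> summable (\<lambda>n. norm (a n * of_real (r ^ n)))"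
    and bd: "\<And>r \<theta>. 0 \<le> r \<Longrightarrow> r < 1 \<Longrightarrow> \<bar>Im (circle_series (\<lambda>n. a n * of_real (r ^ n)) \<theta>)\<bar> \<le> b"
  shows "summable (\<lambda>n. (norm (a n))\<^sup>2)"
proof (rule summableI_nonneg_bounded)
  fix N
  have le: "(\<Sum>n<N. (norm (a n * of_real (r ^ n)))\<^sup>2) \<le> 2 * b\<^sup>2" if r: "0 \<le> r" "r < 1" for r
  proof -
    let ?c = "\<lambda>n. a n * of_real (r ^ n)"
    let ?G = "circle_series ?c"
    note c = sum[OF r]
    note cont = circle_series_continuous[OF c]
    have i: "integrable angle_measure (\<lambda>\<theta>. 2 * (Im (?G \<theta>))\<^sup>2)" "integrable angle_measure (\<lambda>\<theta>. ?G \<theta> * ?G \<theta>)"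
      by (intro integrable_angle continuous_intros cont)+
    have "(\<Sum>n<N. (norm (?c n))\<^sup>2) \<le> (\<Sum>n. (norm (?c n))\<^sup>2)"
      by (rule sum_le_suminf) (use parseval_circle_series[OF c] in \<open>auto simp: sums_iff\<close>)
    also have "\<dots> = integral\<^sup>L angle_measure (\<lambda>\<theta>. (norm (?G \<theta>))\<^sup>2)"
      using parseval_circle_series[OF c] by (simp add: sums_iff)
    also have "(\<lambda>\<theta>. (norm (?G \<theta>))\<^sup>2) = (\<lambda>\<theta>. 2 * (Im (?G \<theta>))\<^sup>2 + Re (?G \<theta> * ?G \<theta>))"
      unfolding cmod_power2 by (simp add: fun_eq_iff power2_eq_square)
    also have "integral\<^sup>L angle_measure (\<lambda>\<theta>. 2 * (Im (?G \<theta>))\<^sup>2 + Re (?G \<theta> * ?G \<theta>))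
        = integral\<^sup>L angle_measure (\<lambda>\<theta>. 2 * (Im (?G \<theta>))\<^sup>2) + Re (integral\<^sup>L angle_measure (\<lambda>\<theta>. ?G \<theta> * ?G \<theta>))"
      unfolding integral_Re[OF i(2), symmetric]
      by (intro Bochner_Integration.integral_add i integrable_Re)
    also have "Re (integral\<^sup>L angle_measure (\<lambda>\<theta>. ?G \<theta> * ?G \<theta>)) = 0"
      unfolding mean_circle_series_square[OF c] by (simp add: a0)
    also have "integral\<^sup>L angle_measure (\<lambda>\<theta>. 2 * (Im (?G \<theta>))\<^sup>2) + 0 \<le> 2 * b\<^sup>2"
    proof -
      have "2 * (Im (?G \<theta>))\<^sup>2 \<le> 2 * b\<^sup>2" for \<theta>
        using power_mono[OF bd[OF r, of \<theta>], of 2] by simp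
      then have "integral\<^sup>L angle_measure (\<lambda>\<theta>. 2 * (Im (?G \<theta>))\<^sup>2) \<le> 2 * b\<^sup>2"
        by (intro angle.integral_le_const i always_eventually allI)
      then show ?thesis by simp
    qed
    finally show ?thesis .
  qed
  have "((\<lambda>r. \<Sum>n<N. (norm (a n * of_real (r ^ n)))\<^sup>2) \<longlongrightarrow> (\<Sum>n<N. (norm (a n * of_real (1 ^ n)))\<^sup>2)) (at_left (1::real))"
    by (intro tendsto_intros)
  moreover have "\<forall>\<^sub>F r in at_left (1::real). (\<Sum>n<N. (norm (a n * of_real (r ^ n)))\<^sup>2) \<le> 2 * b\<^sup>2"
    unfolding eventually_at_left_field using le by (intro exI[of _ 0]) auto
  ultimately have "(\<Sum>n<N. (norm (a n * of_real (1 ^ n)))\<^sup>2) \<le> 2 * b\<^sup>2"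
    by (rule tendsto_upperbound) simp
  then show "(\<Sum>n<N. (norm (a n))\<^sup>2) \<le> 2 * b\<^sup>2" by simp
qed simp

definition circle_borel :: "complex measure" where
  "circle_borel = distr angle_measure (restrict_space borel (sphere 0 1)) cis"

lemma mu0_eq: "mu0 = completion circle_borel"
  by (simp add: mu0_def circle_borel_def angle_measure_def)

lemma measurable_cis_angle [measurable]: "cis \<in> angle_measure \<rightarrow>\<^sub>M restrict_space borel (sphere 0 1)"
proof (rule measurable_restrict_space2)
  show "cis \<in> borel_measurable angle_measure"
    by (intro measurable_angle continuous_intros)
qed auto

lemma sets_circle_borel [measurable_cong]: "sets circle_borel = sets (restrict_space borel (sphere 0 1))"
  by (simp add: circle_borel_def)

lemma space_circle_borel: "space circle_borel = sphere 0 1"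
  by (simp add: circle_borel_def space_restrict_space)

lemma prob_space_mu0: "prob_space mu0"
proof
  have "prob_space circle_borel"
    unfolding circle_borel_def by (rule angle.prob_space_distr[OF measurable_cis_angle])
  then have "emeasure circle_borel (space circle_borel) = 1"
    by (rule prob_space.emeasure_space_1)
  then show "emeasure mu0 (space mu0) = 1" by (simp add: mu0_eq)
qed

lemma integral_mu0:
  fixes h :: "complex \<Rightarrow> complex"
  assumes "continuous_on (sphere 0 1) h"
  shows "h \<in> borel_measurable mu0" and "integral\<^sup>L mu0 h = integral\<^sup>L angle_measure (\<lambda>\<theta>. h (cis \<theta>))"
proof -
  have h: "h \<in> borel_measurable (restrict_space borel (sphere 0 1))"
    by (rule borel_measurable_continuous_on_restrict[OF assms])
  then have h': "h \<in> borel_measurable circle_borel"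
    by (simp add: measurable_cong_sets[OF sets_circle_borel refl])
  then show "h \<in> borel_measurable mu0"
    unfolding mu0_eq by (rule measurable_completion)
  have "integral\<^sup>L mu0 h = integral\<^sup>L circle_borel h"
    unfolding mu0_eq by (rule integral_completion[OF h'])
  also have "\<dots> = integral\<^sup>L angle_measure (\<lambda>\<theta>. h (cis \<theta>))"
    unfolding circle_borel_def by (rule integral_distr[OF measurable_cis_angle h])
  finally show "integral\<^sup>L mu0 h = integral\<^sup>L angle_measure (\<lambda>\<theta>. h (cis \<theta>))" .
qed

lemma borel_measurable_Arg2pi: "Arg2pi \<in> borel_measurable borel"
proof -
  let ?S = "{z. Im z = 0 \<and> 0 \<le> Re z}"
  have "closed ({z. Im z = 0} \<inter> {z. 0 \<le> Re z})"
    by (intro closed_Int closed_Collect_eq closed_Collect_le continuous_intros)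
  moreover have "{z. Im z = 0} \<inter> {z. 0 \<le> Re z} = ?S" by auto
  ultimately have "open (- ?S)" by (simp add: open_closed)
  moreover have "continuous_on (- ?S) Arg2pi"
    by (intro continuous_at_imp_continuous_on ballI continuous_at_Arg2pi)
      (auto simp: complex_nonneg_Reals_iff)
  ultimately have "(\<lambda>z. indicator (- ?S) z *\<^sub>R Arg2pi z) \<in> borel_measurable borel"
    by (intro borel_measurable_continuous_on_indicator) auto
  moreover have "(\<lambda>z. indicator (- ?S) z *\<^sub>R Arg2pi z) = Arg2pi"
    by (auto simp: fun_eq_iff indicator_def Arg2pi_eq_0 complex_is_Real_iff)
  ultimately show ?thesis by simp
qed

text \<open>The image of a null set of angles under \<open>cis\<close> is not obviously a Borel set. It is contained in the
  preimage of a Borel null set under the measurable inverse \<open>Arg2pi\<close> of \<open>cis\<close>.\<close>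

lemma AE_mu0:
  assumes "AE \<theta> in angle_measure. P (cis \<theta>)"
  shows "AE \<zeta> in mu0. P \<zeta>"
proof -
  obtain N where N: "{\<theta>. \<not> P (cis \<theta>)} \<subseteq> N" "emeasure angle_measure N = 0" "N \<in> sets angle_measure"
    using assms by (auto elim: AE_E)
  have NA: "AE \<theta> in angle_measure. \<theta> \<notin> N"
    using N(2,3) by (intro AE_not_in) (simp add: null_sets_def)
  have range: "AE \<theta> in angle_measure. \<theta> \<in> {0..<2 * pi}"
    unfolding angle_measure_def by (rule AE_uniform_measureI) auto
  have "AE \<theta> in angle_measure. Arg2pi (cis \<theta>) \<notin> N"
    using NA range
  proof eventually_elim
    case (elim \<theta>)
    have "Arg2pi (cis \<theta>) = \<theta>"
      by (rule Arg2pi_unique[of 1]) (use elim(2) in \<open>auto simp: cis_conv_exp\<close>)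
    with elim(1) show ?case by simp
  qed
  moreover have "{\<zeta> \<in> space (restrict_space borel (sphere 0 1)). Arg2pi \<zeta> \<notin> N}
      \<in> sets (restrict_space borel (sphere (0::complex) 1))"
  proof -
    have "Arg2pi \<in> borel_measurable (restrict_space borel (sphere 0 1))"
      by (rule measurable_restrict_space1[OF borel_measurable_Arg2pi])
    from measurable_sets[OF this, of "- N"] show ?thesis
      using N(3) by (simp add: vimage_def Int_def conj_commute)
  qed
  ultimately have "AE \<zeta> in circle_borel. Arg2pi \<zeta> \<notin> N"
    unfolding circle_borel_def by (subst AE_distr_iff[OF measurable_cis_angle])
  moreover have "AE \<zeta> in circle_borel. \<zeta> \<in> sphere 0 1"
    using AE_space[of circle_borel] by (simp only: space_circle_borel)
  ultimately have "AE \<zeta> in circle_borel. P \<zeta>"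
  proof eventually_elim
    case (elim \<zeta>)
    have "\<zeta> = cis (Arg2pi \<zeta>)"
      using Arg2pi_eq[of \<zeta>] elim(2) by (simp add: cis_conv_exp)
    with elim(1) N(1) show ?case by (metis (mono_tags, lifting) mem_Collect_eq subsetD)
  qed
  then show ?thesis unfolding mu0_eq by (rule AE_completion)
qed

text \<open>The boundary function takes unspecified values where the radial limit fails to exist; its
  measurability rests on the completeness of the measure.\<close>

lemma measurable_mu0_AE_cong:
  fixes f g :: "complex \<Rightarrow> complex"
  assumes g: "g \<in> borel_measurable mu0" and ae: "AE \<zeta> in mu0. f \<zeta> = g \<zeta>"
  shows "f \<in> borel_measurable mu0"
proof (rule measurableI)
  fix A :: "complex set" assume "A \<in> sets borel"
  then have m: "g -` A \<inter> space mu0 \<in> sets mu0"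
    by (rule measurable_sets[OF g])
  have e: "AE \<zeta> in mu0. \<zeta> \<in> g -` A \<inter> space mu0 \<longleftrightarrow> \<zeta> \<in> f -` A \<inter> space mu0"
    using ae by eventually_elim (simp only: vimage_eq Int_iff)
  show "f -` A \<inter> space mu0 \<in> sets mu0"
    using completion.in_sets_AE[OF e[unfolded mu0_eq] m[unfolded mu0_eq] Int_lower2]
    unfolding mu0_eq .
qed simp

text \<open>The Schwarz formula for an analytic function with bounded imaginary part. On the circle of radius
  \<open>r < 1\<close>, the \<open>j\<close>-th Fourier coefficient of \<open>Im F = (F - cnj F) / (2 i)\<close> is \<open>a\<^sub>j r^j / (2 i)\<close>, as
  \<open>cnj F\<close> has no frequencies above \<open>0\<close>. Then \<open>r\<close> tends to \<open>1\<close>; the integrands are dominated by \<open>b\<close> and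
  converge almost everywhere by Fatou's theorem.\<close>

theorem coefficient_eq_boundary_Im_integral:
  fixes a :: "nat \<Rightarrow> complex" and F :: "complex \<Rightarrow> complex"
  assumes F: "\<And>z. norm z < 1 \<Longrightarrow> (\<lambda>n. a n * z ^ n) sums F z"
    and a0: "a 0 = 0" and bd: "\<And>z. norm z < 1 \<Longrightarrow> \<bar>Im (F z)\<bar> \<le> b" and j: "1 \<le> j"
  defines "\<Xi> \<equiv> \<lambda>\<zeta>. Lim (at_left 1) (\<lambda>r. Im (F (of_real r * \<zeta>)))"
  shows "integrable mu0 (\<lambda>\<zeta>. of_real (\<Xi> \<zeta>) * cnj \<zeta> ^ j)"
    and "a j = 2 * \<i> * (LINT \<zeta>|mu0. of_real (\<Xi> \<zeta>) * cnj \<zeta> ^ j)"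
proof -
  interpret mu0: prob_space mu0 by (rule prob_space_mu0)
  have sum: "summable (\<lambda>n. norm (a n * of_real (r ^ n)))" if r: "0 \<le> r" "r < 1" for r
  proof -
    obtain s where s: "r < s" "s < 1" using dense r(2) by blast
    have "summable (\<lambda>n. a n * of_real s ^ n)"
      using F[of "of_real s"] r s by (auto intro: sums_summable)
    from powser_insidea[OF this, of "of_real r"] show ?thesis using r s by simp
  qed
  have Fc: "F (of_real r * cis \<theta>) = circle_series (\<lambda>n. a n * of_real (r ^ n)) \<theta>"
    if r: "0 \<le> r" "r < 1" for r \<theta>
    using F[of "of_real r * cis \<theta>"] r
    by (simp add: circle_series_def norm_mult sums_iff power_mult_distrib mult.assoc)
  have bc: "\<bar>Im (circle_series (\<lambda>n. a n * of_real (r ^ n)) \<theta>)\<bar> \<le> b" if "0 \<le> r" "r < 1" for r \<theta>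
    using bd[of "of_real r * cis \<theta>"] that by (simp add: Fc norm_mult)
  have sq: "summable (\<lambda>n. (norm (a n))\<^sup>2)"
    by (rule square_summable_of_bounded_Im[OF a0 sum bc])
  have holF: "F holomorphic_on ball 0 1"
    by (rule power_series_holomorphic[of _ _ a]) (use F in simp)
  have lim: "AE \<zeta> in mu0. ((\<lambda>r. Im (F (of_real r * \<zeta>))) \<longlongrightarrow> \<Xi> \<zeta>) (at_left 1)"
  proof (rule AE_mu0)
    show "AE \<theta> in angle_measure. ((\<lambda>r. Im (F (of_real r * cis \<theta>))) \<longlongrightarrow> \<Xi> (cis \<theta>)) (at_left 1)"
      using radial_limits_square_summable[OF sq]
    proof eventually_elim
      case (elim \<theta>)
      then obtain L where "((\<lambda>r. circle_series (\<lambda>n. a n * of_real (r ^ n)) \<theta>) \<longlongrightarrow> L) (at_left 1)" by blast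
      moreover have "\<forall>\<^sub>F r in at_left (1::real). circle_series (\<lambda>n. a n * of_real (r ^ n)) \<theta> = F (of_real r * cis \<theta>)"
        unfolding eventually_at_left_field using Fc by (intro exI[of _ 0]) auto
      ultimately have "((\<lambda>r. F (of_real r * cis \<theta>)) \<longlongrightarrow> L) (at_left 1)"
        by (rule Lim_transform_eventually)
      then have "((\<lambda>r. Im (F (of_real r * cis \<theta>))) \<longlongrightarrow> Im L) (at_left 1)"
        by (rule tendsto_Im)
      moreover from this have "\<Xi> (cis \<theta>) = Im L"
        unfolding \<Xi>_def by (intro tendsto_Lim) simp_all
      ultimately show ?case by simp
    qed
  qed
  define s where "s n = 1 - 1 / (real n + 2)" for n
  have s: "0 \<le> s n" "s n < 1" for n by (auto simp: s_def field_simps)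
  have s_lim: "filterlim s (at_left 1) sequentially"
  proof -
    have "s \<longlonglongrightarrow> 1" unfolding s_def by real_asymp
    then show ?thesis
      using s(2) by (intro tendsto_imp_filterlim_at_left) (auto intro: always_eventually)
  qed
  define g where "g n \<zeta> = complex_of_real (Im (F (of_real (s n) * \<zeta>))) * cnj \<zeta> ^ j" for n \<zeta>
  have contg: "continuous_on (sphere 0 1) (g n)" for n
  proof -
    have "continuous_on (sphere 0 1) (\<lambda>\<zeta>. F (of_real (s n) * \<zeta>))"
      by (rule continuous_on_compose2[OF holomorphic_on_imp_continuous_on[OF holF]])
        (use s[of n] in \<open>auto intro!: continuous_intros simp: norm_mult\<close>)
    then show ?thesis unfolding g_def by (intro continuous_intros)
  qed
  have glim: "AE \<zeta> in mu0. (\<lambda>n. g n \<zeta>) \<longlonglongrightarrow> of_real (\<Xi> \<zeta>) * cnj \<zeta> ^ j"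
    using lim
  proof eventually_elim
    case (elim \<zeta>)
    have "(\<lambda>n. Im (F (of_real (s n) * \<zeta>))) \<longlonglongrightarrow> \<Xi> \<zeta>"
      by (rule filterlim_compose[OF elim s_lim])
    then show ?case unfolding g_def by (intro tendsto_intros)
  qed
  have gm: "g n \<in> borel_measurable mu0" for n by (rule integral_mu0(1)[OF contg])
  have fm: "(\<lambda>\<zeta>. of_real (\<Xi> \<zeta>) * cnj \<zeta> ^ j) \<in> borel_measurable mu0"
  proof (rule measurable_mu0_AE_cong)
    show "(\<lambda>\<zeta>. lim (\<lambda>n. g n \<zeta>)) \<in> borel_measurable mu0"
      by (rule borel_measurable_lim_metric[OF gm])
    show "AE \<zeta> in mu0. of_real (\<Xi> \<zeta>) * cnj \<zeta> ^ j = lim (\<lambda>n. g n \<zeta>)"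
      using glim by eventually_elim (simp add: limI)
  qed
  have sphere: "AE \<zeta> in mu0. \<zeta> \<in> sphere 0 1"
    using AE_space[of mu0] by (simp add: mu0_eq space_circle_borel)
  have gb: "AE \<zeta> in mu0. norm (g n \<zeta>) \<le> b" for n
    using sphere
  proof eventually_elim
    case (elim \<zeta>)
    then have "norm (of_real (s n) * \<zeta>) < 1" using s[of n] by (simp add: norm_mult)
    from bd[OF this] elim show ?case by (simp add: g_def norm_mult norm_power)
  qed
  have const: "integrable mu0 (\<lambda>_. b)" by simp
  show "integrable mu0 (\<lambda>\<zeta>. of_real (\<Xi> \<zeta>) * cnj \<zeta> ^ j)"
    by (rule integrable_dominated_convergence[OF fm gm const glim gb])
  have "(\<lambda>n. integral\<^sup>L mu0 (g n)) \<longlonglongrightarrow> (LINT \<zeta>|mu0. of_real (\<Xi> \<zeta>) * cnj \<zeta> ^ j)"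
    by (rule integral_dominated_convergence[OF fm gm const glim gb])
  moreover have "integral\<^sup>L mu0 (g n) = a j * of_real (s n ^ j) / (2 * \<i>)" for n
  proof -
    let ?c = "\<lambda>m. a m * of_real (s n ^ m)"
    let ?G = "circle_series ?c"
    note c = sum[OF s[of n]]
    note cont = circle_series_continuous[OF c]
    have i: "integrable angle_measure (\<lambda>\<theta>. ?G \<theta> * cnj (cis \<theta> ^ j))"
       "integrable angle_measure (\<lambda>\<theta>. cnj (?G \<theta> * cis \<theta> ^ j))"
      by (intro integrable_angle continuous_intros cont)+
    have ImG: "of_real (Im w) = (w - cnj w) / (2 * \<i>)" for w
      by (simp add: complex_eq_iff Re_divide Im_divide)
    have "integral\<^sup>L mu0 (g n) = integral\<^sup>L angle_measure (\<lambda>\<theta>. g n (cis \<theta>))"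
      by (rule integral_mu0(2)[OF contg])
    also have "\<dots> = integral\<^sup>L angle_measure (\<lambda>\<theta>. (?G \<theta> * cnj (cis \<theta> ^ j) - cnj (?G \<theta> * cis \<theta> ^ j)) / (2 * \<i>))"
      unfolding g_def Fc[OF s[of n]] ImG
      by (simp only: diff_divide_distrib left_diff_distrib complex_cnj_mult complex_cnj_power
          complex_cnj_cnj times_divide_eq_left)
    also have "\<dots> = (integral\<^sup>L angle_measure (\<lambda>\<theta>. ?G \<theta> * cnj (cis \<theta> ^ j))
        - cnj (integral\<^sup>L angle_measure (\<lambda>\<theta>. ?G \<theta> * cis \<theta> ^ j))) / (2 * \<i>)"
      unfolding Bochner_Integration.integral_cnj[symmetric] Bochner_Integration.integral_diff[OF i, symmetric]
      by (rule integral_divide_zero)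
    also have "\<dots> = a j * of_real (s n ^ j) / (2 * \<i>)"
      unfolding mean_circle_series_cnj_power[OF c] mean_circle_series_power[OF c] using j by simp
    finally show ?thesis .
  qed
  moreover have "(\<lambda>n. a j * of_real (s n ^ j) / (2 * \<i>)) \<longlonglongrightarrow> a j * of_real (1 ^ j) / (2 * \<i>)"
  proof -
    have "s \<longlonglongrightarrow> 1" unfolding s_def by real_asymp
    then show ?thesis by (intro tendsto_intros) auto
  qed
  ultimately have "(LINT \<zeta>|mu0. of_real (\<Xi> \<zeta>) * cnj \<zeta> ^ j) = a j * of_real (1 ^ j) / (2 * \<i>)"
    using LIMSEQ_unique by fastforce
  then show "a j = 2 * \<i> * (LINT \<zeta>|mu0. of_real (\<Xi> \<zeta>) * cnj \<zeta> ^ j)" by simp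
qed

section \<open>The logarithm of the diagonal function\<close>

text \<open>Comparison of coefficients in \<open>m' = m l'\<close>, the differential equation satisfied by \<open>l = log m\<close>.\<close>

lemma fps_log_recursion:
  fixes m l :: "complex fps"
  assumes deriv: "fps_deriv m = m * fps_deriv l" and m0: "fps_nth m 0 = 1" and j: "1 \<le> j"
  shows "fps_nth l j = fps_nth m j - (\<Sum>i = 1..j - 1. of_nat i / of_nat j * fps_nth m (j - i) * fps_nth l i)"
proof -
  obtain n where n: "j = Suc n" using j by (cases j) auto
  let ?t = "\<lambda>i. of_nat i * fps_nth l i * fps_nth m (j - i)"
  have "of_nat j * fps_nth m j = fps_nth (fps_deriv l * m) n"
    using arg_cong[OF deriv, of "\<lambda>f. fps_nth f n"] by (simp add: n mult.commute)
  also have "\<dots> = (\<Sum>i = 0..n. ?t (Suc i))"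
    by (simp add: fps_mult_nth n)
  also have "\<dots> = (\<Sum>i = 1..j. ?t i)"
    unfolding n by (simp only: One_nat_def sum.shift_bounds_cl_Suc_ivl)
  also have "\<dots> = (\<Sum>i = 1..j - 1. ?t i) + of_nat j * fps_nth l j"
    by (simp add: n m0)
  finally have "fps_nth l j = (of_nat j * fps_nth m j - (\<Sum>i = 1..j - 1. ?t i)) / of_nat j"
    using j by (simp add: field_simps)
  also have "\<dots> = fps_nth m j - (\<Sum>i = 1..j - 1. ?t i / of_nat j)"
    using j by (simp add: diff_divide_distrib sum_divide_distrib)
  also have "(\<Sum>i = 1..j - 1. ?t i / of_nat j)
      = (\<Sum>i = 1..j - 1. of_nat i / of_nat j * fps_nth m (j - i) * fps_nth l i)"
    by (intro sum.cong) simp_all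
  finally show ?thesis .
qed

text \<open>The principal logarithm is analytic on the right half plane, where the function takes its values;
  its Taylor coefficients obey the recursion that defines \<open>cmv_L\<close>. The value \<open>cmv_L \<alpha> k 0\<close> has no
  meaning, and the constant coefficient is \<open>Ln 1 = 0\<close>.\<close>

lemma Ln_cmv_M11_sums:
  assumes \<alpha>: "\<And>n. cmod (\<alpha> n) < 1" and z: "norm z < 1"
  shows "(\<lambda>j. (if j = 0 then 0 else cmv_L \<alpha> k j) * z ^ j) sums Ln (cmv_M11 \<alpha> z k)"
proof -
  let ?M = "\<lambda>z. cmv_M11 \<alpha> z k" and ?F = "\<lambda>z. Ln (cmv_M11 \<alpha> z k)"
  define m where "m = Abs_fps (\<lambda>j. if j = 0 then 1 else cmv_Mj \<alpha> k j)"
  have Msums: "(\<lambda>j. fps_nth m j * z ^ j) sums ?M z" if "norm z < 1" for z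
    using cmv_M11_sums[OF \<alpha> that, where k = k] by (simp add: m_def)
  have holM: "?M holomorphic_on ball 0 1"
    by (rule power_series_holomorphic[of _ _ "fps_nth m"]) (use Msums in simp)
  have pos: "0 < Re (?M z)" if "norm z < 1" for z
    by (rule Re_cmv_M11_pos[OF \<alpha> that])
  have holF: "?F holomorphic_on ball 0 1"
    by (intro holomorphic_on_Ln' holM) (use pos in \<open>fastforce simp: complex_nonpos_Reals_iff\<close>)
  have ball: "\<forall>\<^sub>F z in nhds 0. z \<in> ball (0::complex) 1"
    by (rule eventually_nhds_in_open) auto
  have M_exp: "?M has_fps_expansion m"
    by (rule has_fps_expansionI) (use ball Msums in \<open>auto elim!: eventually_mono\<close>)
  define l where "l = fps_expansion ?F 0"
  have F_exp: "?F has_fps_expansion l"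
    unfolding l_def
    by (rule analytic_at_imp_has_fps_expansion_0) (use holF in \<open>auto simp: analytic_at intro!: exI[of _ "ball 0 1"]\<close>)
  have "deriv ?M z = ?M z * deriv ?F z" if z: "z \<in> ball 0 1" for z
  proof -
    have "(?F has_field_derivative deriv ?F z) (at z)"
      by (rule holomorphic_derivI[OF holF _ z]) simp
    then have "((\<lambda>w. exp (?F w)) has_field_derivative exp (?F z) * deriv ?F z) (at z)"
      by (rule DERIV_fun_exp)
    moreover have expF: "exp (?F w) = ?M w" if "w \<in> ball 0 1" for w
      using pos[of w] that by (intro exp_Ln) auto
    ultimately have "((\<lambda>w. exp (?F w)) has_field_derivative ?M z * deriv ?F z) (at z)"
      using expF[OF z] by simp
    then have "(?M has_field_derivative ?M z * deriv ?F z) (at z)"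
      by (rule has_field_derivative_transform_within_open[OF _ _ z]) (use expF in auto)
    then show ?thesis by (rule DERIV_imp_deriv)
  qed
  then have "\<forall>\<^sub>F z in nhds 0. deriv ?M z = ?M z * deriv ?F z"
    using ball by (auto elim!: eventually_mono)
  moreover have "(\<lambda>z. ?M z * deriv ?F z) has_fps_expansion m * fps_deriv l"
    by (intro has_fps_expansion_mult has_fps_expansion_deriv M_exp F_exp)
  ultimately have "deriv ?M has_fps_expansion m * fps_deriv l"
    by (subst has_fps_expansion_cong[OF _ refl])
  then have deriv: "fps_deriv m = m * fps_deriv l"
    by (rule fps_expansion_unique_complex[OF has_fps_expansion_deriv[OF M_exp]])
  have l0: "fps_nth l 0 = 0"
    using has_fps_expansion_imp_0_eq_fps_nth_0[OF F_exp] cmv_M11_eq[OF \<alpha>, where z = 0 and k = k] by simp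
  have lj: "fps_nth l j = cmv_L \<alpha> k j" if "1 \<le> j" for j
    using that
  proof (induction j rule: less_induct)
    case (less j)
    have "fps_nth l j = fps_nth m j - (\<Sum>i = 1..j - 1. of_nat i / of_nat j * fps_nth m (j - i) * fps_nth l i)"
      by (rule fps_log_recursion[OF deriv _ less.prems]) (simp add: m_def)
    also have "(\<Sum>i = 1..j - 1. of_nat i / of_nat j * fps_nth m (j - i) * fps_nth l i)
        = (\<Sum>i = 1..j - 1. of_nat i / of_nat j * cmv_Mj \<alpha> k (j - i) * cmv_L \<alpha> k i)"
      by (intro sum.cong refl) (use less.IH in \<open>auto simp: m_def\<close>)
    also have "fps_nth m j = cmv_Mj \<alpha> k j" using less.prems by (simp add: m_def)
    finally show ?case by (subst cmv_L.simps) auto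
  qed
  have "(\<lambda>j. fps_nth l j * z ^ j) sums ?F z"
    by (rule has_fps_expansion_imp_sums_complex[OF F_exp, of 1])
      (use holF z in \<open>simp_all add: one_ereal_def\<close>)
  moreover have "fps_nth l j = (if j = 0 then 0 else cmv_L \<alpha> k j)" for j
    using l0 lj[of j] by simp
  ultimately show ?thesis by simp
qed

theorem theorem2p2:
  fixes \<alpha> :: "int \<Rightarrow> complex" and k :: int
  assumes "\<And>n. cmod (\<alpha> n) < 1"
  shows "(\<forall>j\<ge>1.
            integrable mu0 (\<lambda>\<zeta>. of_real (cmv_Xi11 \<alpha> \<zeta> k) * cnj \<zeta> ^ j) \<and>
            cmv_L \<alpha> k j = 2 * \<i> * (LINT \<zeta>|mu0. of_real (cmv_Xi11 \<alpha> \<zeta> k) * cnj \<zeta> ^ j)) \<and>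
         cmv_L \<alpha> k 1 = - 2 * \<alpha> k * cnj (\<alpha> (k + 1)) \<and>
         - 2 * \<alpha> k * cnj (\<alpha> (k + 1)) = 2 * \<i> * (LINT \<zeta>|mu0. of_real (cmv_Xi11 \<alpha> \<zeta> k) * cnj \<zeta>)"
proof -
  let ?a = "\<lambda>j. if j = 0 then 0 else cmv_L \<alpha> k j"
  have sums: "(\<lambda>j. ?a j * z ^ j) sums Ln (cmv_M11 \<alpha> z k)" if "norm z < 1" for z
    by (rule Ln_cmv_M11_sums[OF assms that])
  have bound: "\<bar>Im (Ln (cmv_M11 \<alpha> z k))\<bar> \<le> pi / 2" if "norm z < 1" for z
    using Re_Ln_pos_lt_imp[OF Re_cmv_M11_pos[where \<alpha> = \<alpha> and k = k, OF assms that]] by simp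
  note main = coefficient_eq_boundary_Im_integral[of ?a, OF sums _ bound, folded cmv_Xi11_def]
  have all: "integrable mu0 (\<lambda>\<zeta>. of_real (cmv_Xi11 \<alpha> \<zeta> k) * cnj \<zeta> ^ j) \<and>
      cmv_L \<alpha> k j = 2 * \<i> * (LINT \<zeta>|mu0. of_real (cmv_Xi11 \<alpha> \<zeta> k) * cnj \<zeta> ^ j)" if "1 \<le> j" for j
    using main[OF _ _ _ that] that by simp
  have "cmv_L \<alpha> k 1 = cmv_Mj \<alpha> k 1" by (subst cmv_L.simps) simp
  then have one: "cmv_L \<alpha> k 1 = - 2 * \<alpha> k * cnj (\<alpha> (k + 1))"
    by (simp only: cmv_Mj_1[OF assms])
  with all[of 1] all show ?thesis by simp
qed

end
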